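(* There is a universal constant $c>0$ such that for all $H,B,\Delta,\sigma>0$, any $K\ge2$, $M,R\ge1$, and any dimension at least $3$: there exist $F_0\in\mathcal{F}_0(H,B)$ and a stochastic gradient oracle for $F_0$ with variance at most $\sigma^2$ such that the final averaged iterate $\hat x$ of Local SGD (homogeneous setting) initialized at $0$ with any fixed stepsize has suboptimality at least $$\mathbb{E}F_0(\hat x)-F_0^*\ \ge\ c\cdot\left(\min\left\{\frac{(H\sigma^2B^4)^{1/3}}{K^{2/3}R^{2/3}},\,HB^2\right\}+\min\left\{\frac{\sigma B}{\sqrt{MKR}},\,HB^2\right\}\right).$$ Similarly, for any $0<\lambda\le\frac{H}{16}$, there exist $F_\lambda\in\mathcal{F}_\lambda(H,\Delta)$ and a stochastic gradient oracle for $F_\lambda$ with variance at most $\sigma^2$ such that the final averaged iterate of Local SGD initialized at $0$ with any fixed stepsize has suboptimality at least $$\mathbb{E}F_\lambda(\hat x)-F_\lambda^*\ \ge\ c\cdot\left(\min\left\{\frac{H\sigma^2}{\lambda^2K^2R^2},\,\Delta\right\}+\min\left\{\frac{\sigma^2}{\lambda MKR},\,\Delta\right\}\right).$$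
   Context: $\mathcal{F}_0(H,B)$: convex, $H$-smooth (gradient $H$-Lipschitz) functions $F:\mathbb{R}^d\to\mathbb{R}$ with a minimizer $x^*$, $\|x^*\|\le B$. $\mathcal{F}_\lambda(H,\Delta)$: $\lambda$-strongly convex, $H$-smooth functions with $F(0)-\min_xF(x)\le\Delta$. $F^*=\min F$. A stochastic gradient oracle with variance at most $\sigma^2$ is $g(x;z)$ with $\mathbb{E}_zg(x;z)=\nabla F(x)$ and $\mathbb{E}_z\|g(x;z)-\nabla F(x)\|^2\le\sigma^2$ for all $x$; all machines use the same oracle with i.i.d. draws of $z$ over machines and steps. Local SGD with fixed stepsize $\eta$, $M$ machines, $R$ rounds and $K$ steps per round: $x^m_{0,0}=0$ for all $m$; for $r=0,\dots,R-1$: for $k=0,\dots,K-1$ and each $m$, $x^m_{k+1,r}=x^m_{k,r}-\eta\,g(x^m_{k,r};z^m_{k,r})$; then for each $m$, $x^m_{0,r+1}=\frac1M\sum_{m'}x^{m'}_{K,r}$. The final averaged iterate is $\hat x=\frac1M\sum_{m}x^m_{K,R-1}$. *)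

theory Defs
  imports "HOL-Probability.Probability"
begin

text \<open>
  The constant in the lower bound must not depend on the dimension, so the dimension is a
  natural number d rather than a type. The space of dimension d is the carrier of the library's
  \<^const>\<open>Euclidean_space\<close>: the functions from nat to real that vanish at all indices
  from d on. Its norm is \<^const>\<open>L2_set\<close> over the first d coordinates. Functions on it are
  total functions whose values off the carrier are irrelevant.
\<close>

abbreviation Rn :: "nat \<Rightarrow> (nat \<Rightarrow> real) set" where
  "Rn d \<equiv> topspace (Euclidean_space d)"

definition norm_Rn :: "nat \<Rightarrow> (nat \<Rightarrow> real) \<Rightarrow> real" where
  "norm_Rn d x = L2_set x {..<d}"

definition inner_Rn :: "nat \<Rightarrow> (nat \<Rightarrow> real) \<Rightarrow> (nat \<Rightarrow> real) \<Rightarrow> real" where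
  "inner_Rn d x y = (\<Sum>i<d. x i * y i)"

text \<open>Frechet differentiability at x with gradient v.\<close>

definition has_gradient ::
    "nat \<Rightarrow> ((nat \<Rightarrow> real) \<Rightarrow> real) \<Rightarrow> (nat \<Rightarrow> real) \<Rightarrow> (nat \<Rightarrow> real) \<Rightarrow> bool" where
  "has_gradient d F v x \<longleftrightarrow> v \<in> Rn d \<and>
     (\<forall>e>0. \<exists>\<delta>>0. \<forall>y\<in>Rn d. norm_Rn d (\<lambda>i. y i - x i) < \<delta> \<longrightarrow>
        \<bar>F y - F x - inner_Rn d v (\<lambda>i. y i - x i)\<bar> \<le> e * norm_Rn d (\<lambda>i. y i - x i))"

definition smooth_Rn :: "nat \<Rightarrow> real \<Rightarrow> ((nat \<Rightarrow> real) \<Rightarrow> real) \<Rightarrow> bool" where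
  "smooth_Rn d H F \<longleftrightarrow> (\<exists>G. (\<forall>x\<in>Rn d. has_gradient d F (G x) x) \<and>
     (\<forall>x\<in>Rn d. \<forall>y\<in>Rn d.
        norm_Rn d (\<lambda>i. G x i - G y i) \<le> H * norm_Rn d (\<lambda>i. x i - y i)))"

definition convex_Rn :: "nat \<Rightarrow> ((nat \<Rightarrow> real) \<Rightarrow> real) \<Rightarrow> bool" where
  "convex_Rn d F \<longleftrightarrow> (\<forall>x\<in>Rn d. \<forall>y\<in>Rn d. \<forall>t\<in>{0..1}.
     F (\<lambda>i. (1 - t) * x i + t * y i) \<le> (1 - t) * F x + t * F y)"

definition strongly_convex_Rn :: "nat \<Rightarrow> real \<Rightarrow> ((nat \<Rightarrow> real) \<Rightarrow> real) \<Rightarrow> bool" where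
  "strongly_convex_Rn d \<mu> F \<longleftrightarrow> (\<forall>x\<in>Rn d. \<forall>y\<in>Rn d. \<forall>t\<in>{0..1}.
     F (\<lambda>i. (1 - t) * x i + t * y i)
       \<le> (1 - t) * F x + t * F y - \<mu> / 2 * t * (1 - t) * (norm_Rn d (\<lambda>i. x i - y i))\<^sup>2)"

text \<open>Below, this is only used for functions that attain their minimum.\<close>

definition min_value :: "nat \<Rightarrow> ((nat \<Rightarrow> real) \<Rightarrow> real) \<Rightarrow> real" where
  "min_value d F = (INF x\<in>Rn d. F x)"

definition convex_class :: "nat \<Rightarrow> real \<Rightarrow> real \<Rightarrow> ((nat \<Rightarrow> real) \<Rightarrow> real) set" where
  "convex_class d H B = {F. convex_Rn d F \<and> smooth_Rn d H F \<and>
     (\<exists>x. is_arg_min F (\<lambda>y. y \<in> Rn d) x \<and> norm_Rn d x \<le> B)}"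

definition strongly_convex_class ::
    "nat \<Rightarrow> real \<Rightarrow> real \<Rightarrow> real \<Rightarrow> ((nat \<Rightarrow> real) \<Rightarrow> real) set" where
  "strongly_convex_class d \<mu> H \<Delta> = {F. strongly_convex_Rn d \<mu> F \<and> smooth_Rn d H F \<and>
     (\<exists>x. is_arg_min F (\<lambda>y. y \<in> Rn d) x) \<and> F (\<lambda>_. 0) - min_value d F \<le> \<Delta>}"

text \<open>
  D is the law of z. Joint measurability makes the iterates of the algorithm random variables.
  The integrability conditions are explicit because the Bochner integral of a non-integrable
  function is 0.
\<close>

definition stochastic_gradient_oracle ::
    "nat \<Rightarrow> ((nat \<Rightarrow> real) \<Rightarrow> real) \<Rightarrow> real \<Rightarrow> 'z measure \<Rightarrow>
     ((nat \<Rightarrow> real) \<Rightarrow> 'z \<Rightarrow> (nat \<Rightarrow> real)) \<Rightarrow> bool" where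
  "stochastic_gradient_oracle d F \<sigma> D g \<longleftrightarrow> prob_space D \<and>
     (\<lambda>(x, z). g x z) \<in> restrict_space borel (Rn d) \<Otimes>\<^sub>M D \<rightarrow>\<^sub>M restrict_space borel (Rn d) \<and>
     (\<forall>x\<in>Rn d. \<exists>v. has_gradient d F v x \<and>
        (\<forall>i<d. integrable D (\<lambda>z. g x z i) \<and> (\<integral>z. g x z i \<partial>D) = v i) \<and>
        integrable D (\<lambda>z. (norm_Rn d (\<lambda>i. g x z i - v i))\<^sup>2) \<and>
        (\<integral>z. (norm_Rn d (\<lambda>i. g x z i - v i))\<^sup>2 \<partial>D) \<le> \<sigma>\<^sup>2)"

text \<open>k stochastic gradient steps with stepsize eta from x, the j-th step using the sample z j.\<close>

primrec sgd_steps ::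
    "((nat \<Rightarrow> real) \<Rightarrow> 'z \<Rightarrow> (nat \<Rightarrow> real)) \<Rightarrow> real \<Rightarrow> (nat \<Rightarrow> 'z) \<Rightarrow> (nat \<Rightarrow> real) \<Rightarrow>
     nat \<Rightarrow> (nat \<Rightarrow> real)" where
  "sgd_steps g \<eta> z x 0 = x"
| "sgd_steps g \<eta> z x (Suc k) =
     (\<lambda>i. sgd_steps g \<eta> z x k i - \<eta> * g (sgd_steps g \<eta> z x k) (z k) i)"

text \<open>
  The sample used by machine m in step k of round r is \<open>z (m, k, r)\<close>. The point from which a
  round starts is the same for all machines.
\<close>

primrec round_start ::
    "((nat \<Rightarrow> real) \<Rightarrow> 'z \<Rightarrow> (nat \<Rightarrow> real)) \<Rightarrow> real \<Rightarrow> nat \<Rightarrow> nat \<Rightarrow>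
     (nat \<times> nat \<times> nat \<Rightarrow> 'z) \<Rightarrow> nat \<Rightarrow> (nat \<Rightarrow> real)" where
  "round_start g \<eta> M K z 0 = (\<lambda>_. 0)"
| "round_start g \<eta> M K z (Suc r) =
     (\<lambda>i. (\<Sum>m<M. sgd_steps g \<eta> (\<lambda>k. z (m, k, r)) (round_start g \<eta> M K z r) K i) / real M)"

definition local_iterate ::
    "((nat \<Rightarrow> real) \<Rightarrow> 'z \<Rightarrow> (nat \<Rightarrow> real)) \<Rightarrow> real \<Rightarrow> nat \<Rightarrow> nat \<Rightarrow>
     (nat \<times> nat \<times> nat \<Rightarrow> 'z) \<Rightarrow> nat \<Rightarrow> nat \<Rightarrow> nat \<Rightarrow> (nat \<Rightarrow> real)" where
  "local_iterate g \<eta> M K z m k r =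
     sgd_steps g \<eta> (\<lambda>j. z (m, j, r)) (round_start g \<eta> M K z r) k"

definition local_sgd_output ::
    "((nat \<Rightarrow> real) \<Rightarrow> 'z \<Rightarrow> (nat \<Rightarrow> real)) \<Rightarrow> real \<Rightarrow> nat \<Rightarrow> nat \<Rightarrow> nat \<Rightarrow>
     (nat \<times> nat \<times> nat \<Rightarrow> 'z) \<Rightarrow> (nat \<Rightarrow> real)" where
  "local_sgd_output g \<eta> M K R z =
     (\<lambda>i. (\<Sum>m<M. local_iterate g \<eta> M K z m K (R - 1) i) / real M)"

text \<open>The joint law of i.i.d. samples with law D, indexed by machine, step and round.\<close>

definition iid_samples :: "'z measure \<Rightarrow> (nat \<times> nat \<times> nat \<Rightarrow> 'z) measure" where
  "iid_samples D = (\<Pi>\<^sub>M j\<in>UNIV. D)"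

text \<open>
  The expected suboptimality of the output is well-defined and at least l. Integrability is part
  of the claim, so that the Bochner integral is the expectation.
\<close>

definition local_sgd_suboptimality_ge ::
    "nat \<Rightarrow> ((nat \<Rightarrow> real) \<Rightarrow> real) \<Rightarrow> 'z measure \<Rightarrow>
     ((nat \<Rightarrow> real) \<Rightarrow> 'z \<Rightarrow> (nat \<Rightarrow> real)) \<Rightarrow> real \<Rightarrow> nat \<Rightarrow> nat \<Rightarrow> nat \<Rightarrow> real \<Rightarrow> bool" where
  "local_sgd_suboptimality_ge d F D g \<eta> M K R l \<longleftrightarrow>
     integrable (iid_samples D) (\<lambda>z. F (local_sgd_output g \<eta> M K R z)) \<and>
     (\<integral>z. F (local_sgd_output g \<eta> M K R z) \<partial>iid_samples D) - min_value d F \<ge> l"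

end

theory Submission
  imports Defs
begin

text \<open>
  The objective is a sum of one-dimensional functions, so the coordinates of Local SGD do not
  interact, and only one of them is noisy, with steps \<open>\<plusminus>\<sigma>\<close>. Since the constant c is
  free, it is enough to treat the larger of the two terms, so two families of instances suffice.

  For the statistical term, the noisy coordinate is quadratic with curvature \<open>\<mu>\<close>. The second
  moment of the averaged error satisfies the recursion
  \<open>V' = (1 - \<eta> \<mu>)\<^sup>2 V + \<eta>\<^sup>2 \<sigma>\<^sup>2 / M\<close>, so either the initial error survives or V reaches the
  order of the stationary value, about \<open>\<eta> \<sigma>\<^sup>2 / (\<mu> M)\<close>, while \<open>\<eta> \<ge> 1 / (2 \<mu> K R)\<close>.

  For the drift term, the noisy coordinate has curvature L on the left of 0 and 2 L on the right.
  Its expectation satisfies \<open>E x' = (1 - \<eta> L) E x - \<eta> L E (max x 0)\<close>, and as soon as one local noisy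
  step has been made, \<open>E (max x 0) \<ge> (E x + \<eta> \<sigma>) / 2\<close>. This pushes E x down to a negative multiple
  of \<open>\<eta> \<sigma>\<close>, and averaging over the machines does not change expectations. Only the first local step
  of a round can fail to contribute, which is harmless since K is at least 2.
\<close>

section \<open>Separable objectives\<close>

text \<open>With \<open>c = 0\<close> this is a plain quadratic about \<open>b\<close>; a positive
  \<open>c\<close> adds curvature on the right of 0 only and keeps the derivative Lipschitz. One
  family thus covers every coordinate used.\<close>

definition piece :: "real \<Rightarrow> real \<Rightarrow> real \<Rightarrow> real \<Rightarrow> real" where
  "piece a b c x = a / 2 * (x - b)\<^sup>2 + c / 2 * (max x 0)\<^sup>2"

definition piece_deriv :: "real \<Rightarrow> real \<Rightarrow> real \<Rightarrow> real \<Rightarrow> real" where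
  "piece_deriv a b c x = a * (x - b) + c * max x 0"

text \<open>The expression is the remainder of the tangent expansion of
  \<open>(max x 0)\<^sup>2\<close>, whose derivative is \<open>2 * max x 0\<close>. Its two bounds
  are convexity and 2-smoothness; for x and y on different sides of 0 they rest on
  \<open>x * y \<le> 0\<close>.\<close>

lemma pos_part_sq_remainder:
  fixes x y :: real
  shows "0 \<le> (max y 0)\<^sup>2 - (max x 0)\<^sup>2 - 2 * max x 0 * (y - x)"
    and "(max y 0)\<^sup>2 - (max x 0)\<^sup>2 - 2 * max x 0 * (y - x) \<le> (y - x)\<^sup>2"
proof -
  have *: "0 \<le> (y - x) * (y - x)" "0 \<le> x * x" "0 \<le> y * y" by simp_all
  then have "2 * (x * y) \<le> x * x + y * y" by (simp add: algebra_simps)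
  note * = * this
  have xy: "x * y \<le> 0" if "x \<le> 0 \<and> 0 \<le> y \<or> y \<le> 0 \<and> 0 \<le> x"
    using that by (auto simp: mult_nonneg_nonpos mult_nonpos_nonneg)
  show "0 \<le> (max y 0)\<^sup>2 - (max x 0)\<^sup>2 - 2 * max x 0 * (y - x)"
    by (cases "x \<le> 0"; cases "y \<le> 0"; simp add: max_def power2_eq_square algebra_simps;
      use * xy in linarith)
  show "(max y 0)\<^sup>2 - (max x 0)\<^sup>2 - 2 * max x 0 * (y - x) \<le> (y - x)\<^sup>2"
    by (cases "x \<le> 0"; cases "y \<le> 0"; simp add: max_def power2_eq_square algebra_simps;
      use * xy in linarith)
qed

lemma piece_remainder:
  assumes "0 \<le> a" "0 \<le> c"
  shows "\<bar>piece a b c y - piece a b c x - piece_deriv a b c x * (y - x)\<bar> \<le> (a + c) / 2 * (y - x)\<^sup>2"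
proof -
  define r where "r = (max y 0)\<^sup>2 - (max x 0)\<^sup>2 - 2 * max x 0 * (y - x)"
  have r: "0 \<le> r" "r \<le> (y - x)\<^sup>2"
    unfolding r_def using pos_part_sq_remainder by blast+
  have "piece a b c y - piece a b c x - piece_deriv a b c x * (y - x)
      = a / 2 * (y - x)\<^sup>2 + c / 2 * r"
    by (simp add: piece_def piece_deriv_def r_def power2_eq_square field_simps)
  moreover have "0 \<le> a / 2 * (y - x)\<^sup>2" "0 \<le> c / 2 * r" "c / 2 * r \<le> c / 2 * (y - x)\<^sup>2"
    using assms r by (auto intro!: mult_left_mono)
  ultimately show ?thesis by (simp add: algebra_simps add_divide_distrib)
qed

lemma piece_deriv_lipschitz:
  assumes "0 \<le> a" "0 \<le> c"
  shows "\<bar>piece_deriv a b c x - piece_deriv a b c y\<bar> \<le> (a + c) * \<bar>x - y\<bar>"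
proof -
  have "\<bar>max x 0 - max y 0\<bar> \<le> \<bar>x - y\<bar>" by (auto simp: max_def)
  then have "c * \<bar>max x 0 - max y 0\<bar> \<le> c * \<bar>x - y\<bar>"
    using assms by (intro mult_left_mono)
  moreover have "piece_deriv a b c x - piece_deriv a b c y = a * (x - y) + c * (max x 0 - max y 0)"
    by (simp add: piece_deriv_def algebra_simps)
  moreover have "\<bar>a * (x - y) + c * (max x 0 - max y 0)\<bar> \<le> a * \<bar>x - y\<bar> + c * \<bar>max x 0 - max y 0\<bar>"
    using assms abs_triangle_ineq[of "a * (x - y)" "c * (max x 0 - max y 0)"] by (simp add: abs_mult)
  ultimately show ?thesis by (simp only: distrib_right)
qed

text \<open>The quadratic part meets the strong convexity inequality with equality. The other part
  is convex: its tangent inequalities at \<open>w\<close>, weighted by \<open>1 - t\<close> and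
  \<open>t\<close>, add up so that the linear terms cancel.\<close>

lemma piece_strongly_convex:
  assumes "0 \<le> c" and t: "t \<in> {0..1}"
  shows "piece a b c ((1 - t) * x + t * y)
    \<le> (1 - t) * piece a b c x + t * piece a b c y - a / 2 * t * (1 - t) * (x - y)\<^sup>2"
proof -
  define w where "w = (1 - t) * x + t * y"
  have "0 \<le> (1 - t) * ((max x 0)\<^sup>2 - (max w 0)\<^sup>2 - 2 * max w 0 * (x - w))
      + t * ((max y 0)\<^sup>2 - (max w 0)\<^sup>2 - 2 * max w 0 * (y - w))"
    using t by (intro add_nonneg_nonneg mult_nonneg_nonneg pos_part_sq_remainder) auto
  also have "\<dots> = (1 - t) * (max x 0)\<^sup>2 + t * (max y 0)\<^sup>2 - (max w 0)\<^sup>2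
      - 2 * max w 0 * ((1 - t) * x + t * y - w)"
    by (simp add: algebra_simps)
  finally have "(max w 0)\<^sup>2 \<le> (1 - t) * (max x 0)\<^sup>2 + t * (max y 0)\<^sup>2" by (simp add: w_def)
  then have "c / 2 * (max w 0)\<^sup>2 \<le> c / 2 * ((1 - t) * (max x 0)\<^sup>2 + t * (max y 0)\<^sup>2)"
    using assms by (intro mult_left_mono) auto
  then have "c / 2 * (max w 0)\<^sup>2 \<le> (1 - t) * (c / 2 * (max x 0)\<^sup>2) + t * (c / 2 * (max y 0)\<^sup>2)"
    by (simp only: distrib_left mult.left_commute mult.commute mult.assoc)
  moreover have "a / 2 * (w - b)\<^sup>2 = (1 - t) * (a / 2 * (x - b)\<^sup>2) + t * (a / 2 * (y - b)\<^sup>2)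
      - a / 2 * t * (1 - t) * (x - y)\<^sup>2"
    by (simp add: w_def power2_eq_square field_simps)
  ultimately show ?thesis unfolding piece_def w_def[symmetric] distrib_left by linarith
qed

section \<open>Sums of pieces: gradient, smoothness, strong convexity, minimum\<close>

definition separable ::
  "nat \<Rightarrow> (nat \<Rightarrow> real) \<Rightarrow> (nat \<Rightarrow> real) \<Rightarrow> (nat \<Rightarrow> real) \<Rightarrow> (nat \<Rightarrow> real) \<Rightarrow> real" where
  "separable d a b c x = (\<Sum>i<d. piece (a i) (b i) (c i) (x i))"

definition separable_grad ::
  "nat \<Rightarrow> (nat \<Rightarrow> real) \<Rightarrow> (nat \<Rightarrow> real) \<Rightarrow> (nat \<Rightarrow> real) \<Rightarrow> (nat \<Rightarrow> real) \<Rightarrow> nat \<Rightarrow> real" where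
  "separable_grad d a b c x i = (if i < d then piece_deriv (a i) (b i) (c i) (x i) else 0)"

lemma mem_Rn: "x \<in> Rn d \<longleftrightarrow> (\<forall>i\<ge>d. x i = 0)"
  by (simp add: topspace_Euclidean_space)

lemma norm_Rn_sq: "(norm_Rn d x)\<^sup>2 = (\<Sum>i<d. (x i)\<^sup>2)"
  by (simp add: norm_Rn_def L2_set_def sum_nonneg)

lemma norm_Rn_nonneg: "0 \<le> norm_Rn d x"
  by (simp add: norm_Rn_def)

text \<open>Assumption \<open>b_c\<close> makes b i the minimizer of the i-th piece, with value 0.\<close>

locale separable_objective =
  fixes d :: nat and a b c :: "nat \<Rightarrow> real" and \<mu> H :: real
  assumes mu_pos: "0 < \<mu>"
    and a_ge: "\<And>i. i < d \<Longrightarrow> \<mu> \<le> a i"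
    and c_nonneg: "\<And>i. i < d \<Longrightarrow> 0 \<le> c i"
    and ac_le: "\<And>i. i < d \<Longrightarrow> a i + c i \<le> H"
    and b_c: "\<And>i. i < d \<Longrightarrow> b i = 0 \<or> c i = 0"
    and b_Rn: "b \<in> Rn d"
begin

abbreviation "F \<equiv> separable d a b c"
abbreviation "G \<equiv> separable_grad d a b c"

lemma a_pos: "i < d \<Longrightarrow> 0 < a i"
  using mu_pos a_ge[of i] by linarith

lemma has_gradient_F: "has_gradient d F (G x) x"
  unfolding has_gradient_def
proof (intro conjI allI impI)
  show "G x \<in> Rn d" by (simp add: mem_Rn separable_grad_def)
  fix e :: real assume e: "0 < e"
  \<comment> \<open>The remainder will be at most \<open>C * ?n\<^sup>2\<close>, hence the radius
    \<open>e / C\<close>. The added 1 keeps C positive even for \<open>d = 0\<close>, where the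
    locale does not constrain H.\<close>
  define C where "C = \<bar>H\<bar> + 1"
  have C: "0 < C" by (simp add: C_def)
  show "\<exists>\<delta>>0. \<forall>y\<in>Rn d. norm_Rn d (\<lambda>i. y i - x i) < \<delta> \<longrightarrow>
        \<bar>F y - F x - inner_Rn d (G x) (\<lambda>i. y i - x i)\<bar> \<le> e * norm_Rn d (\<lambda>i. y i - x i)"
  proof (intro exI[of _ "e / C"] conjI ballI impI)
    show "0 < e / C" using e C by simp
    fix y
    let ?n = "norm_Rn d (\<lambda>i. y i - x i)"
    assume n: "?n < e / C"
    have "\<bar>F y - F x - inner_Rn d (G x) (\<lambda>i. y i - x i)\<bar>
        = \<bar>\<Sum>i<d. piece (a i) (b i) (c i) (y i) - piece (a i) (b i) (c i) (x i)
             - piece_deriv (a i) (b i) (c i) (x i) * (y i - x i)\<bar>"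
      by (simp add: separable_def inner_Rn_def separable_grad_def sum_subtractf)
    also have "\<dots> \<le> (\<Sum>i<d. C * (y i - x i)\<^sup>2)"
    proof (rule order_trans[OF sum_abs], rule sum_mono)
      fix i assume i: "i \<in> {..<d}"
      have "\<bar>piece (a i) (b i) (c i) (y i) - piece (a i) (b i) (c i) (x i)
             - piece_deriv (a i) (b i) (c i) (x i) * (y i - x i)\<bar> \<le> (a i + c i) / 2 * (y i - x i)\<^sup>2"
        using i a_pos[of i] c_nonneg by (intro piece_remainder) auto
      also have "\<dots> \<le> C * (y i - x i)\<^sup>2"
        using i ac_le[of i] a_pos[of i] c_nonneg[of i] unfolding C_def
        by (intro mult_right_mono) auto
      finally show "\<bar>piece (a i) (b i) (c i) (y i) - piece (a i) (b i) (c i) (x i)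
             - piece_deriv (a i) (b i) (c i) (x i) * (y i - x i)\<bar> \<le> C * (y i - x i)\<^sup>2" .
    qed
    also have "\<dots> = C * ?n\<^sup>2"
      by (simp add: sum_distrib_left[symmetric] norm_Rn_sq)
    also have "\<dots> = (C * ?n) * ?n"
      by (simp add: power2_eq_square)
    also have "\<dots> \<le> e * ?n"
      using n C norm_Rn_nonneg by (intro mult_right_mono) (auto simp: field_simps)
    finally show "\<bar>F y - F x - inner_Rn d (G x) (\<lambda>i. y i - x i)\<bar> \<le> e * ?n" .
  qed
qed

text \<open>The gradient acts coordinate by coordinate, so a common bound on the coordinate
  Lipschitz constants is enough, whatever the dimension.\<close>

lemma smooth_F:
  assumes "0 \<le> H"
  shows "smooth_Rn d H F"
  unfolding smooth_Rn_def
proof (intro exI[of _ G] conjI ballI has_gradient_F)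
  fix x y
  have "norm_Rn d (\<lambda>i. G x i - G y i) \<le> L2_set (\<lambda>i. H * \<bar>x i - y i\<bar>) {..<d}"
    unfolding norm_Rn_def L2_set_def
  proof (intro real_sqrt_le_mono sum_mono)
    fix i assume i: "i \<in> {..<d}"
    have "\<bar>G x i - G y i\<bar> \<le> (a i + c i) * \<bar>x i - y i\<bar>"
      using i piece_deriv_lipschitz[of "a i" "c i" "b i" "x i" "y i"] a_pos[of i] c_nonneg
      by (auto simp: separable_grad_def)
    also have "\<dots> \<le> H * \<bar>x i - y i\<bar>" using i ac_le by (intro mult_right_mono) auto
    finally have "\<bar>G x i - G y i\<bar>\<^sup>2 \<le> (H * \<bar>x i - y i\<bar>)\<^sup>2" by (intro power_mono) auto
    then show "(G x i - G y i)\<^sup>2 \<le> (H * \<bar>x i - y i\<bar>)\<^sup>2" by simp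
  qed
  also have "\<dots> = H * norm_Rn d (\<lambda>i. x i - y i)"
    using assms by (simp add: norm_Rn_def L2_set_def power_mult_distrib sum_distrib_left[symmetric]
      real_sqrt_mult)
  finally show "norm_Rn d (\<lambda>i. G x i - G y i) \<le> H * norm_Rn d (\<lambda>i. x i - y i)" .
qed

lemma strongly_convex_F: "strongly_convex_Rn d \<mu> F"
  unfolding strongly_convex_Rn_def
proof (intro ballI)
  fix x y :: "nat \<Rightarrow> real" and t :: real assume t: "t \<in> {0..1}"
  have "F (\<lambda>i. (1 - t) * x i + t * y i) \<le>
    (\<Sum>i<d. (1 - t) * piece (a i) (b i) (c i) (x i) + t * piece (a i) (b i) (c i) (y i)
        - \<mu> / 2 * t * (1 - t) * (x i - y i)\<^sup>2)"
    unfolding separable_def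
  proof (rule sum_mono)
    fix i assume i: "i \<in> {..<d}"
    have "\<mu> / 2 * (t * (1 - t) * (x i - y i)\<^sup>2) \<le> a i / 2 * (t * (1 - t) * (x i - y i)\<^sup>2)"
      using i t a_ge by (intro mult_right_mono) auto
    moreover have "piece (a i) (b i) (c i) ((1 - t) * x i + t * y i)
      \<le> (1 - t) * piece (a i) (b i) (c i) (x i) + t * piece (a i) (b i) (c i) (y i)
        - a i / 2 * t * (1 - t) * (x i - y i)\<^sup>2"
      using piece_strongly_convex i c_nonneg t by blast
    ultimately show "piece (a i) (b i) (c i) ((1 - t) * x i + t * y i)
      \<le> (1 - t) * piece (a i) (b i) (c i) (x i) + t * piece (a i) (b i) (c i) (y i)
        - \<mu> / 2 * t * (1 - t) * (x i - y i)\<^sup>2" by (simp add: mult.assoc)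
  qed
  also have "\<dots> = (1 - t) * F x + t * F y - \<mu> / 2 * t * (1 - t) * (norm_Rn d (\<lambda>i. x i - y i))\<^sup>2"
    by (simp add: separable_def norm_Rn_sq sum.distrib sum_subtractf sum_distrib_left)
  finally show "F (\<lambda>i. (1 - t) * x i + t * y i) \<le>
    (1 - t) * F x + t * F y - \<mu> / 2 * t * (1 - t) * (norm_Rn d (\<lambda>i. x i - y i))\<^sup>2" .
qed

lemma piece_nonneg: "i < d \<Longrightarrow> 0 \<le> piece (a i) (b i) (c i) x"
  using a_pos[of i] c_nonneg[of i] by (simp add: piece_def)

lemma piece_le_F: "i < d \<Longrightarrow> piece (a i) (b i) (c i) (x i) \<le> F x"
  unfolding separable_def
  by (rule member_le_sum[where f = "\<lambda>i. piece (a i) (b i) (c i) (x i)"]) (auto simp: piece_nonneg)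

lemma F_nonneg: "0 \<le> F x"
  unfolding separable_def by (intro sum_nonneg) (auto simp: piece_nonneg)

lemma F_b: "F b = 0"
  using b_c by (force simp: separable_def piece_def intro!: sum.neutral)

lemma is_arg_min_F: "is_arg_min F (\<lambda>y. y \<in> Rn d) b"
  using b_Rn by (simp add: is_arg_min_def F_b F_nonneg not_less)

lemma min_value_F: "min_value d F = 0"
  unfolding min_value_def
  by (rule cInf_eq_minimum) (use b_Rn F_b F_nonneg in \<open>auto intro: rev_image_eqI\<close>)

end

section \<open>Independent fair signs\<close>

definition coin :: "real measure" where
  "coin = measure_pmf (pmf_of_set {-1, 1})"

text \<open>The sample space of \<open>coin\<close> is the whole real line, with mass only at -1 and
  1. Reading off a sign makes the noise a unit sign at every point, not just almost everywhere, so
  iterates are bounded pointwise.\<close>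

definition noise :: "real \<Rightarrow> real" where
  "noise z = (if z > 0 then 1 else -1)"

text \<open>Unlike negation, this reverses \<open>noise\<close> at 0 as well, so
  \<open>noise_flip\<close> holds without exceptional points.\<close>

definition flip :: "real \<Rightarrow> real" where
  "flip z = (if z > 0 then -1 else 1)"

lemma noise_flip: "noise (flip z) = - noise z"
  by (simp add: noise_def flip_def)

lemma abs_noise: "\<bar>noise z\<bar> = 1"
  by (simp add: noise_def)

lemma noise_sq: "(noise z)\<^sup>2 = 1"
  by (simp add: noise_def)

lemma sets_coin: "sets coin = UNIV"
  by (simp add: coin_def)

lemma space_coin: "space coin = UNIV"
  by (simp add: coin_def)

lemma prob_space_coin: "prob_space coin"
  by (simp add: coin_def measure_pmf.prob_space_axioms)

lemma measurable_coin: "f \<in> coin \<rightarrow>\<^sub>M N \<longleftrightarrow> f \<in> UNIV \<rightarrow> space N"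
  by (auto simp: measurable_def sets_coin space_coin)

lemma integrable_coin: "integrable coin (f :: real \<Rightarrow> real)"
  unfolding coin_def by (rule integrable_measure_pmf_finite) simp

lemma integral_coin: "(\<integral>z. f z \<partial>coin) = (f (-1) + f 1) / (2::real)"
  unfolding coin_def by (subst integral_pmf_of_set) auto

lemma distr_coin_flip: "distr coin coin flip = coin"
proof -
  have "map_pmf flip (pmf_of_set {-1, 1}) = pmf_of_set (flip ` {-1, 1})"
    by (rule map_pmf_of_set_inj) (auto simp: inj_on_def flip_def)
  also have "flip ` {-1, 1} = {-1, 1}" by (auto simp: flip_def)
  finally have "measure_pmf (map_pmf flip (pmf_of_set {-1, 1})) = coin"
    by (simp add: coin_def)
  then have "distr (measure_pmf (pmf_of_set {-1, 1})) (count_space UNIV) flip = coin"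
    by (simp add: map_pmf_rep_eq)
  moreover have "distr coin coin flip = distr coin (count_space UNIV) flip"
    by (rule distr_cong) (simp_all add: sets_coin)
  ultimately show ?thesis by (simp add: coin_def)
qed

section \<open>The space of i.i.d. signs and its symmetries\<close>

abbreviation "samples \<equiv> iid_samples coin"

interpretation samples: prob_space samples
  unfolding iid_samples_def by (rule prob_space_PiM) (rule prob_space_coin)

lemma space_samples: "space samples = UNIV"
  by (simp add: iid_samples_def space_PiM space_coin)

lemma measurable_sample: "(\<lambda>z. z j) \<in> samples \<rightarrow>\<^sub>M coin"
  unfolding iid_samples_def by (rule measurable_component_singleton) simp

lemma measurable_flip_sample: "(\<lambda>z. z(j := flip (z j))) \<in> samples \<rightarrow>\<^sub>M samples"
  unfolding iid_samples_def
proof (rule measurable_PiM_single')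
  fix i
  have "(\<lambda>z. flip (z j)) \<in> samples \<rightarrow>\<^sub>M coin"
    by (rule measurable_compose[OF measurable_sample]) (simp add: measurable_coin space_coin)
  then show "(\<lambda>z. (z(j := flip (z j))) i) \<in> Pi\<^sub>M UNIV (\<lambda>j. coin) \<rightarrow>\<^sub>M coin"
    using measurable_sample[of i] by (cases "i = j") (auto simp: iid_samples_def)
qed (auto simp: space_coin)

text \<open>All independence arguments below are reduced to this symmetry.\<close>

lemma distr_flip_sample: "distr samples samples (\<lambda>z. z(j := flip (z j))) = samples"
proof -
  let ?T = "\<lambda>z. z(j := flip (z j))"
  interpret product_prob_space "\<lambda>_. coin" UNIV
    by (simp add: product_prob_space_def product_prob_space_axioms_def product_sigma_finite_def
        prob_space_coin prob_space_imp_sigma_finite)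
  have sp: "space (Pi\<^sub>M UNIV (\<lambda>_. coin)) = UNIV" by (simp add: space_PiM space_coin)
  have "distr samples samples ?T = Pi\<^sub>M UNIV (\<lambda>_. coin)"
  \<comment> \<open>A product measure is determined by finite cylinders. The preimage of a cylinder
    is again a cylinder, with side j replaced by its preimage under \<open>flip\<close>, which has
    the same mass.\<close>
  proof (rule PiM_eq)
    fix J and A :: "nat \<times> nat \<times> nat \<Rightarrow> real set"
    assume J: "finite J" "J \<subseteq> UNIV" and A: "\<And>i. i \<in> J \<Longrightarrow> A i \<in> sets coin"
    let ?E = "\<lambda>A. prod_emb UNIV (\<lambda>_. coin) J (Pi\<^sub>E J A)"
    let ?B = "\<lambda>i. if i = j then flip -` A i else A i"
    have E: "?E A \<in> sets (Pi\<^sub>M UNIV (\<lambda>_. coin))" for A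
      using J by (intro sets_PiM_I) (auto simp: sets_coin)
    have emb: "?E A = {z. \<forall>i\<in>J. z i \<in> A i}" for A
      by (simp only: prod_emb_def space_coin restrict_PiE_iff extensional_UNIV PiE_UNIV_domain)
        auto
    have "?T z i \<in> A i \<longleftrightarrow> z i \<in> ?B i" for z i by simp
    then have pre: "?T -` ?E A \<inter> space samples = ?E ?B"
      by (simp only: emb space_samples vimage_Collect_eq Int_UNIV_right)
    have flip_A: "emeasure coin (flip -` X) = emeasure coin X" for X
      using emeasure_distr[of flip coin coin X]
      by (simp add: distr_coin_flip measurable_coin space_coin sets_coin)
    have "emeasure (distr samples samples ?T) (?E A) = emeasure samples (?E ?B)"
      unfolding pre[symmetric] using E[of A]
      by (intro emeasure_distr[OF measurable_flip_sample]) (simp add: iid_samples_def)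
    also have "\<dots> = (\<Prod>i\<in>J. emeasure coin (?B i))"
      unfolding iid_samples_def using J by (intro emeasure_PiM_emb) (auto simp: sets_coin)
    also have "\<dots> = (\<Prod>i\<in>J. emeasure coin (A i))"
      by (intro prod.cong) (auto simp: flip_A)
    finally show "emeasure (distr samples samples ?T) (?E A) = (\<Prod>i\<in>J. emeasure coin (A i))" .
  qed (simp add: iid_samples_def)
  then show ?thesis by (simp add: iid_samples_def)
qed

lemma expectation_flip:
  fixes f :: "(nat \<times> nat \<times> nat \<Rightarrow> real) \<Rightarrow> real"
  assumes "f \<in> borel_measurable samples"
  shows "samples.expectation (\<lambda>z. f (z(j := flip (z j)))) = samples.expectation f"
  using integral_distr[OF measurable_flip_sample[of j] assms] by (simp add: distr_flip_sample)

text \<open>This class is closed under all operations of the algorithm and the objective and lies in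
  the integrable functions, so every integrability condition reduces to closure rules.\<close>

definition bounded_rv :: "((nat \<times> nat \<times> nat \<Rightarrow> real) \<Rightarrow> real) \<Rightarrow> bool" where
  "bounded_rv f \<longleftrightarrow> f \<in> borel_measurable samples \<and> (\<exists>C. \<forall>z. \<bar>f z\<bar> \<le> C)"

lemma bounded_rv_measurable: "bounded_rv f \<Longrightarrow> f \<in> borel_measurable samples"
  by (simp add: bounded_rv_def)

lemma bounded_rv_integrable: "bounded_rv f \<Longrightarrow> integrable samples f"
  unfolding bounded_rv_def by (auto intro!: samples.integrable_const_bound AE_I2)

lemma bounded_rv_const: "bounded_rv (\<lambda>_. C)"
  unfolding bounded_rv_def by auto

lemma bounded_rv_add:
  assumes "bounded_rv f" "bounded_rv g"
  shows "bounded_rv (\<lambda>z. f z + g z)"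
proof -
  obtain A B where "\<And>z. \<bar>f z\<bar> \<le> A" "\<And>z. \<bar>g z\<bar> \<le> B"
    using assms by (auto simp: bounded_rv_def)
  then have "\<bar>f z + g z\<bar> \<le> A + B" for z
    by (meson abs_triangle_ineq add_mono order_trans)
  then show ?thesis using assms by (auto simp: bounded_rv_def)
qed

lemma bounded_rv_mult:
  assumes "bounded_rv f" "bounded_rv g"
  shows "bounded_rv (\<lambda>z. f z * g z)"
proof -
  obtain A B where "\<And>z. \<bar>f z\<bar> \<le> A" "\<And>z. \<bar>g z\<bar> \<le> B"
    using assms by (auto simp: bounded_rv_def)
  then have "\<bar>f z * g z\<bar> \<le> A * B" for z
    unfolding abs_mult by (intro mult_mono) (auto intro: order_trans[OF abs_ge_zero])
  then show ?thesis using assms by (auto simp: bounded_rv_def)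
qed

lemma bounded_rv_cmult: "bounded_rv f \<Longrightarrow> bounded_rv (\<lambda>z. C * f z)"
  by (rule bounded_rv_mult[OF bounded_rv_const])

lemma bounded_rv_diff: "bounded_rv f \<Longrightarrow> bounded_rv g \<Longrightarrow> bounded_rv (\<lambda>z. f z - g z)"
  using bounded_rv_add[of f "\<lambda>z. -1 * g z"] bounded_rv_cmult[of g "-1"] by simp

lemma bounded_rv_divide: "bounded_rv f \<Longrightarrow> bounded_rv (\<lambda>z. f z / C)"
  using bounded_rv_cmult[of f "1 / C"] by simp

lemma bounded_rv_power2: "bounded_rv f \<Longrightarrow> bounded_rv (\<lambda>z. (f z)\<^sup>2)"
  unfolding power2_eq_square by (rule bounded_rv_mult)

lemma bounded_rv_sum: "(\<And>i. i \<in> I \<Longrightarrow> bounded_rv (f i)) \<Longrightarrow> bounded_rv (\<lambda>z. \<Sum>i\<in>I. f i z)"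
  by (induction I rule: infinite_finite_induct) (auto intro: bounded_rv_const bounded_rv_add)

lemma bounded_rv_pos_part:
  assumes "bounded_rv f"
  shows "bounded_rv (\<lambda>z. max (f z) 0)"
proof -
  obtain A where "\<And>z. \<bar>f z\<bar> \<le> A" using assms by (auto simp: bounded_rv_def)
  then have "\<bar>max (f z) 0\<bar> \<le> A" for z
    using order_trans[OF abs_ge_zero, of "f z" A] abs_le_D1[of "f z" A] by (simp add: max_def)
  then show ?thesis using assms by (auto simp: bounded_rv_def)
qed

lemma bounded_rv_noise: "bounded_rv (\<lambda>z. noise (z j))"
proof -
  have "(\<lambda>z. noise (z j)) \<in> borel_measurable samples"
    by (rule measurable_compose[OF measurable_sample]) (simp add: measurable_coin)
  then show ?thesis unfolding bounded_rv_def by (auto simp: abs_noise)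
qed

lemmas bounded_rv_intros = bounded_rv_const bounded_rv_add bounded_rv_mult bounded_rv_diff
  bounded_rv_divide bounded_rv_power2 bounded_rv_sum bounded_rv_pos_part bounded_rv_noise

text \<open>Flipping sample j preserves the law, fixes \<open>A\<close> and negates the noise, so
  the expectation equals its own negative. Invariance under overwriting sample j stands in for
  independence.\<close>

lemma expectation_mult_noise:
  assumes A: "bounded_rv A" and ind: "\<And>z w. A (z(j := w)) = A z"
  shows "samples.expectation (\<lambda>z. A z * noise (z j)) = 0"
proof -
  have "samples.expectation (\<lambda>z. A z * noise (z j))
      = samples.expectation (\<lambda>z. A (z(j := flip (z j))) * noise ((z(j := flip (z j))) j))"
    by (intro expectation_flip[symmetric] bounded_rv_measurable bounded_rv_intros A)
  also have "\<dots> = - samples.expectation (\<lambda>z. A z * noise (z j))"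
    by (simp add: ind noise_flip)
  finally show ?thesis by simp
qed

lemma expectation_noise: "samples.expectation (\<lambda>z. noise (z j)) = 0"
  using expectation_mult_noise[of "\<lambda>_. 1" j] by (simp add: bounded_rv_const)

text \<open>One of the two arguments is \<open>u + \<bar>s\<bar>\<close>, and the other positive
  part is nonnegative.\<close>

lemma sum_two_pos_parts: "u + \<bar>s\<bar> \<le> max (u - s) 0 + max (u + s) (0::real)"
  by (auto simp: max_def abs_if)

text \<open>The curvature jump of the objective at 0 turns this lower bound into a drift.\<close>

lemma expectation_pos_part_noise:
  assumes u: "bounded_rv u" and ind: "\<And>z w. u (z(j := w)) = u z"
  shows "(samples.expectation u + \<bar>s\<bar>) / 2
    \<le> samples.expectation (\<lambda>z. max (u z - s * noise (z j)) 0)"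
proof -
  let ?f = "\<lambda>z. max (u z - s * noise (z j)) 0" and ?g = "\<lambda>z. max (u z + s * noise (z j)) 0"
  have f: "bounded_rv ?f" and g: "bounded_rv ?g" by (intro bounded_rv_intros u)+
  \<comment> \<open>The flip exchanges the two signs, so both positive parts have the same mean and
    each carries half of the pointwise bound on their sum.\<close>
  have "samples.expectation ?g = samples.expectation (\<lambda>z. ?f (z(j := flip (z j))))"
    by (simp add: ind noise_flip)
  also have "\<dots> = samples.expectation ?f" by (intro expectation_flip bounded_rv_measurable f)
  finally have eq: "samples.expectation ?g = samples.expectation ?f" .
  have "samples.expectation u + \<bar>s\<bar> = samples.expectation (\<lambda>z. u z + \<bar>s\<bar>)"
    using bounded_rv_integrable[OF u] by (simp add: samples.prob_space)
  also have "\<dots> \<le> samples.expectation (\<lambda>z. ?f z + ?g z)"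
  proof (rule integral_mono)
    show "u z + \<bar>s\<bar> \<le> ?f z + ?g z" for z
      using sum_two_pos_parts[of "u z" "s * noise (z j)"] by (simp add: abs_mult abs_noise)
  qed (intro bounded_rv_integrable bounded_rv_intros u)+
  also have "\<dots> = 2 * samples.expectation ?f"
    using eq f g by (simp add: bounded_rv_integrable)
  finally show ?thesis by simp
qed

text \<open>In the expanded square the off-diagonal products have mean 0, leaving M diagonal ones
  over \<open>(real M)\<^sup>2\<close>. This is the source of M in the statistical term.\<close>

lemma expectation_mean_noise_sq:
  fixes k r :: nat
  assumes "M \<ge> 1"
  shows "samples.expectation (\<lambda>z. ((\<Sum>m<M. noise (z (m, k, r))) / real M)\<^sup>2) = 1 / real M"
proof -
  have int: "integrable samples (\<lambda>z. noise (z i) * noise (z j))" for i j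
    by (intro bounded_rv_integrable bounded_rv_intros)
  have E: "samples.expectation (\<lambda>z. noise (z (m, k, r)) * noise (z (m', k, r))) = (if m = m' then 1 else 0)"
    for m m'
  proof (cases "m = m'")
    case True
    then show ?thesis by (simp add: power2_eq_square[symmetric] noise_sq samples.prob_space)
  next
    case False
    then show ?thesis
      using expectation_mult_noise[of "\<lambda>z. noise (z (m, k, r))" "(m', k, r)"]
      by (simp add: bounded_rv_noise)
  qed
  have "samples.expectation (\<lambda>z. ((\<Sum>m<M. noise (z (m, k, r))) / real M)\<^sup>2)
      = samples.expectation (\<lambda>z. (\<Sum>m<M. \<Sum>m'<M. noise (z (m, k, r)) * noise (z (m', k, r))) / (real M)\<^sup>2)"
    by (simp add: power_divide power2_eq_square sum_product)
  also have "\<dots> = (\<Sum>m<M. \<Sum>m'<M. if m = m' then 1 else 0) / (real M)\<^sup>2"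
    by (simp add: int E)
  also have "\<dots> = 1 / real M"
    using assms by (simp add: power2_eq_square)
  finally show ?thesis .
qed

section \<open>Local SGD with one noisy coordinate\<close>

lemma sgd_steps_cong:
  "(\<And>j. j < k \<Longrightarrow> z j = z' j) \<Longrightarrow> sgd_steps g \<eta> z x k = sgd_steps g \<eta> z' x k"
  by (induction k) auto

text \<open>Adaptedness, phrased as invariance under overwriting a current or later sample: the form
  in which \<open>expectation_mult_noise\<close> and \<open>expectation_pos_part_noise\<close> take
  independence.\<close>

lemma round_start_update:
  "r \<le> snd (snd j) \<Longrightarrow> round_start g \<eta> M K (z(j := w)) r = round_start g \<eta> M K z r"
proof (induction r)
  case (Suc r)
  have "sgd_steps g \<eta> (\<lambda>k. (z(j := w)) (m, k, r)) x K = sgd_steps g \<eta> (\<lambda>k. z (m, k, r)) x K" for m x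
    using Suc.prems by (intro sgd_steps_cong) auto
  with Suc show ?case by simp
qed simp

text \<open>Within a round the machines do not interact, so the step index matters only when the
  overwritten sample belongs to the same machine.\<close>

lemma local_iterate_update:
  assumes "m = fst j \<Longrightarrow> k \<le> fst (snd j)" and "r = snd (snd j)"
  shows "local_iterate g \<eta> M K (z(j := w)) m k r = local_iterate g \<eta> M K z m k r"
proof -
  have "sgd_steps g \<eta> (\<lambda>k. (z(j := w)) (m, k, r)) x k = sgd_steps g \<eta> (\<lambda>k. z (m, k, r)) x k" for x
    using assms by (intro sgd_steps_cong) (cases j, auto)
  then show ?thesis unfolding local_iterate_def using assms by (simp add: round_start_update)
qed

text \<open>The output is the start of a further round R. At \<open>R = 0\<close> truncated
  subtraction would instead return the result of round 0.\<close>

lemma local_sgd_output_eq_round_start: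
  "R \<ge> 1 \<Longrightarrow> local_sgd_output g \<eta> M K R z = round_start g \<eta> M K z R"
  by (cases R) (auto simp: local_sgd_output_def local_iterate_def)

section \<open>The stochastic gradient oracle\<close>

locale noisy_objective = separable_objective +
  fixes n :: nat and \<sigma> :: real
  assumes n_lt: "n < d"
begin

definition noisy_grad :: "(nat \<Rightarrow> real) \<Rightarrow> real \<Rightarrow> nat \<Rightarrow> real" where
  "noisy_grad x z i = G x i + (if i = n then \<sigma> * noise z else 0)"

lemma noisy_grad_eq:
  "i < d \<Longrightarrow> noisy_grad x z i = piece_deriv (a i) (b i) (c i) (x i) + (if i = n then \<sigma> else 0) * noise z"
  by (simp add: noisy_grad_def separable_grad_def)

lemma measurable_noisy_grad:
  "(\<lambda>(x, z). noisy_grad x z) \<in> restrict_space borel (Rn d) \<Otimes>\<^sub>M coin \<rightarrow>\<^sub>M restrict_space borel (Rn d)"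
proof (rule measurable_restrict_space2)
  show "(\<lambda>(x, z). noisy_grad x z) \<in> space (restrict_space borel (Rn d) \<Otimes>\<^sub>M coin) \<rightarrow> Rn d"
    using n_lt by (auto simp: mem_Rn noisy_grad_def separable_grad_def)
  have "(\<lambda>x. x i) \<in> borel_measurable (restrict_space (borel :: (nat \<Rightarrow> real) measure) (Rn d))" for i
    by (intro measurable_restrict_space1) measurable
  then have x: "(\<lambda>p. fst p i) \<in> borel_measurable (restrict_space borel (Rn d) \<Otimes>\<^sub>M coin)"
    for i :: nat by (intro measurable_compose[OF measurable_fst])
  have [measurable]: "noise \<in> borel_measurable coin" by (simp add: measurable_coin)
  \<comment> \<open>Coordinatewise measurability suffices for the product Borel structure;
    coordinates from d on are constantly 0.\<close>
  have "(\<lambda>p. noisy_grad (fst p) (snd p) i) \<in> borel_measurable (restrict_space borel (Rn d) \<Otimes>\<^sub>M coin)"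
    for i
  proof (cases "i < d")
    case True
    note [measurable] = x[of i]
    show ?thesis unfolding noisy_grad_eq[OF True] piece_deriv_def by measurable
  next
    case False
    then show ?thesis using n_lt by (simp add: noisy_grad_def separable_grad_def)
  qed
  then show "(\<lambda>(x, z). noisy_grad x z) \<in> borel_measurable (restrict_space borel (Rn d) \<Otimes>\<^sub>M coin)"
    unfolding case_prod_beta by (intro measurable_coordinatewise_then_product)
qed

lemma stochastic_gradient_oracle: "stochastic_gradient_oracle d F \<sigma> coin noisy_grad"
  unfolding stochastic_gradient_oracle_def
proof (intro conjI ballI prob_space_coin measurable_noisy_grad)
  fix x
  have "(\<integral>z. noisy_grad x z i \<partial>coin) = G x i" for i
    by (simp add: integral_coin noisy_grad_def noise_def)
  \<comment> \<open>Only coordinate n is perturbed, by a sign times \<open>\<sigma>\<close>, so the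
    squared deviation is the same for every sample.\<close>
  moreover have "(norm_Rn d (\<lambda>i. noisy_grad x z i - G x i))\<^sup>2 = \<sigma>\<^sup>2" for z
  proof -
    have "(norm_Rn d (\<lambda>i. noisy_grad x z i - G x i))\<^sup>2 = (\<Sum>i<d. if i = n then \<sigma>\<^sup>2 else 0)"
      unfolding norm_Rn_sq by (intro sum.cong) (auto simp: noisy_grad_def power_mult_distrib noise_sq)
    then show ?thesis using n_lt by simp
  qed
  ultimately show "\<exists>v. has_gradient d F v x \<and>
        (\<forall>i<d. integrable coin (\<lambda>z. noisy_grad x z i) \<and> (\<integral>z. noisy_grad x z i \<partial>coin) = v i) \<and>
        integrable coin (\<lambda>z. (norm_Rn d (\<lambda>i. noisy_grad x z i - v i))\<^sup>2) \<and>
        (\<integral>z. (norm_Rn d (\<lambda>i. noisy_grad x z i - v i))\<^sup>2 \<partial>coin) \<le> \<sigma>\<^sup>2"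
    using has_gradient_F[of x] prob_space.prob_space[OF prob_space_coin]
    by (intro exI[of _ "G x"]) (simp add: integrable_coin)
qed

end

locale local_sgd_run = noisy_objective +
  fixes \<eta> :: real and M K :: nat
  assumes M_ge: "M \<ge> 1"
begin

abbreviation "start z r \<equiv> round_start noisy_grad \<eta> M K z r"
abbreviation "iter z m k r \<equiv> local_iterate noisy_grad \<eta> M K z m k r"
abbreviation "E \<equiv> samples.expectation"

lemma iter_0: "iter z m 0 r = start z r"
  by (simp add: local_iterate_def)

lemma iter_Suc:
  assumes "i < d"
  shows "iter z m (Suc k) r i = iter z m k r i - \<eta> * piece_deriv (a i) (b i) (c i) (iter z m k r i)
      - \<eta> * (if i = n then \<sigma> else 0) * noise (z (m, k, r))"
  using assms by (simp add: local_iterate_def noisy_grad_eq algebra_simps)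

lemma start_Suc: "start z (Suc r) i = (\<Sum>m<M. iter z m K r i) / real M"
  by (simp add: local_iterate_def)

declare round_start.simps(2) [simp del]

text \<open>Each iterate is built from finitely many bounded noises by the closure operations. The
  bound may grow with k and r and with any \<open>\<eta>\<close>; only its existence is
  used.\<close>

lemma bounded_rv_iter_start:
  assumes "i < d"
  shows "bounded_rv (\<lambda>z. start z r i)" and "bounded_rv (\<lambda>z. iter z m k r i)"
proof -
  have iter: "bounded_rv (\<lambda>z. iter z m k r i)" if "bounded_rv (\<lambda>z. start z r i)" for m k r
  proof (induction k)
    case (Suc k)
    then show ?case unfolding iter_Suc[OF assms] piece_deriv_def by (intro bounded_rv_intros)
  qed (simp add: iter_0 that)
  show start: "bounded_rv (\<lambda>z. start z r i)" for r
  proof (induction r)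
    case (Suc r)
    then show ?case unfolding start_Suc by (intro bounded_rv_intros iter)
  qed (simp add: bounded_rv_const)
  show "bounded_rv (\<lambda>z. iter z m k r i)" by (rule iter[OF start])
qed

lemma bounded_rv_F_start: "bounded_rv (\<lambda>z. F (start z r))"
  unfolding separable_def piece_def
  by (intro bounded_rv_intros bounded_rv_iter_start) auto

lemma suboptimalityI:
  assumes "R \<ge> 1" and "l \<le> E (\<lambda>z. F (start z R))"
  shows "local_sgd_suboptimality_ge d F coin noisy_grad \<eta> M K R l"
  unfolding local_sgd_suboptimality_ge_def local_sgd_output_eq_round_start[OF assms(1)] min_value_F
  using assms bounded_rv_integrable[OF bounded_rv_F_start] by simp

text \<open>All pieces are nonnegative, so the suboptimality can be bounded through whichever
  coordinate is bad for the given stepsize.\<close>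

lemma expectation_piece_le:
  assumes "i < d"
  shows "E (\<lambda>z. piece (a i) (b i) (c i) (start z r i)) \<le> E (\<lambda>z. F (start z r))"
proof (rule integral_mono)
  show "integrable samples (\<lambda>z. piece (a i) (b i) (c i) (start z r i))"
    unfolding piece_def using assms
    by (intro bounded_rv_integrable bounded_rv_intros bounded_rv_iter_start)
qed (intro bounded_rv_integrable bounded_rv_F_start piece_le_F assms)+

text \<open>Without noise all machines agree and averaging does nothing; each of the
  \<open>K * r\<close> steps multiplies the error, initially \<open>- b i\<close>, by
  \<open>1 - \<eta> * a i\<close>.\<close>

lemma start_noiseless:
  assumes "i < d" "i \<noteq> n" "c i = 0"
  shows "start z r i - b i = - b i * (1 - \<eta> * a i) ^ (K * r)"
proof (induction r)
  case (Suc r)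
  have "iter z m k r i - b i = (start z r i - b i) * (1 - \<eta> * a i) ^ k" for m k
  proof (induction k)
    case (Suc k)
    have "iter z m (Suc k) r i - b i = (iter z m k r i - b i) * (1 - \<eta> * a i)"
      using assms by (simp add: iter_Suc piece_deriv_def algebra_simps)
    then show ?case using Suc by simp
  qed (simp add: iter_0)
  then have "iter z m K r i = b i - b i * (1 - \<eta> * a i) ^ (K * Suc r)" for m
    using Suc by (simp add: power_add algebra_simps)
  then show ?case using M_ge by (simp add: start_Suc)
qed simp

lemma noiseless_error:
  assumes "i < d" "i \<noteq> n" "c i = 0"
  shows "a i / 2 * (b i)\<^sup>2 * (1 - \<eta> * a i) ^ (2 * (K * r)) \<le> E (\<lambda>z. F (start z r))"
proof -
  have *: "piece (a i) (b i) (c i) (start z r i) = a i / 2 * (b i)\<^sup>2 * (1 - \<eta> * a i) ^ (2 * (K * r))"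
    for z
    using assms
    by (simp add: piece_def start_noiseless power_mult_distrib power_mult[symmetric] mult.commute)
  show ?thesis using expectation_piece_le[OF assms(1), of r] unfolding * by (simp add: samples.prob_space)
qed

subsection \<open>Variance of the averaged noise\<close>

text \<open>For \<open>c n = 0\<close> the steps are affine, so the average over machines follows a
  single SGD run with noise variance \<open>\<sigma>\<^sup>2 / M\<close>. \<open>W\<close> may be
  any subsolution of its second moment recursion: a geometric one keeps the initial error, a
  constant one captures the noise floor.\<close>

lemma second_moment_recursion:
  fixes W :: "nat \<Rightarrow> real"
  assumes c: "c n = 0"
    and W0: "W 0 \<le> (b n)\<^sup>2"
    and W: "\<And>t. W (Suc t) \<le> (1 - \<eta> * a n)\<^sup>2 * W t + \<eta>\<^sup>2 * \<sigma>\<^sup>2 / real M"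
  shows "W (K * r) \<le> E (\<lambda>z. (start z r n - b n)\<^sup>2)"
proof (induction r)
  case 0
  then show ?case using W0 by (simp add: samples.prob_space)
next
  case (Suc r)
  \<comment> \<open>The error of the average over machines, followed also inside a round: at
    \<open>k = 0\<close> it is the error of the round start, at \<open>k = K\<close> that of the
    next one.\<close>
  define Y where "Y k z = (\<Sum>m<M. iter z m k r n) / real M - b n" for k z
  have Y_rv: "bounded_rv (Y k)" for k
    unfolding Y_def using n_lt by (intro bounded_rv_intros bounded_rv_iter_start)
  have "W (K * r + k) \<le> E (\<lambda>z. (Y k z)\<^sup>2)" for k
  proof (induction k)
    case 0
    then show ?case using Suc M_ge by (simp add: Y_def iter_0)
  next
    case (Suc k)
    define q where "q = 1 - \<eta> * a n"
    define N where "N z = (\<Sum>m<M. noise (z (m, k, r))) / real M" for z :: "nat \<times> nat \<times> nat \<Rightarrow> real"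
    have N_rv: "bounded_rv N" unfolding N_def by (intro bounded_rv_intros)
    have step: "Y (Suc k) z = q * Y k z - \<eta> * \<sigma> * N z" for z
      using n_lt c M_ge
      by (simp add: Y_def N_def q_def iter_Suc piece_deriv_def sum_subtractf sum_distrib_left[symmetric]
          field_simps sum.distrib)
    \<comment> \<open>\<open>Y k\<close> involves only samples before step k of this round, so it is
      orthogonal to the noise of that step.\<close>
    have "E (\<lambda>z. Y k z * noise (z (m, k, r))) = 0" for m
      by (rule expectation_mult_noise[OF Y_rv]) (simp add: Y_def local_iterate_update)
    moreover have "Y k z * N z = (\<Sum>m<M. Y k z * noise (z (m, k, r))) / real M" for z
      by (simp add: N_def sum_distrib_left)
    ultimately have cross: "E (\<lambda>z. Y k z * N z) = 0"
      using Y_rv by (simp only:) (simp add: bounded_rv_integrable bounded_rv_mult bounded_rv_noise)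
    have "E (\<lambda>z. (Y (Suc k) z)\<^sup>2)
        = E (\<lambda>z. q\<^sup>2 * (Y k z)\<^sup>2 + \<eta>\<^sup>2 * \<sigma>\<^sup>2 * (N z)\<^sup>2 - 2 * q * \<eta> * \<sigma> * (Y k z * N z))"
      by (simp add: step power2_eq_square algebra_simps)
    also have "\<dots> = q\<^sup>2 * E (\<lambda>z. (Y k z)\<^sup>2) + \<eta>\<^sup>2 * \<sigma>\<^sup>2 * E (\<lambda>z. (N z)\<^sup>2)
        - 2 * q * \<eta> * \<sigma> * E (\<lambda>z. Y k z * N z)"
      by (simp add: bounded_rv_integrable bounded_rv_intros Y_rv N_rv)
    also have "\<dots> = q\<^sup>2 * E (\<lambda>z. (Y k z)\<^sup>2) + \<eta>\<^sup>2 * \<sigma>\<^sup>2 / real M"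
      unfolding cross using expectation_mean_noise_sq[OF M_ge, of k r] by (simp add: N_def)
    also have "\<dots> \<ge> q\<^sup>2 * W (K * r + k) + \<eta>\<^sup>2 * \<sigma>\<^sup>2 / real M"
      using Suc by (intro add_right_mono mult_left_mono) auto
    finally show ?case using W[of "K * r + k"] by (simp add: q_def)
  qed
  from this[of K] show ?case by (simp add: Y_def start_Suc add.commute)
qed

subsection \<open>Drift caused by local noise\<close>

text \<open>With \<open>\<theta> = \<eta> * L\<close> and \<open>s = \<eta> * \<sigma>\<close>, a
  step preceded by a local noisy step sends the mean e to at most
  \<open>p * e - \<theta> * s / 2\<close>, where \<open>p = 1 - 3 / 2 * \<theta>\<close>. The fixed
  point is \<open>- s / 3\<close>; the idle first step of each round costs a factor 2. The bound on
  \<open>\<eta> * L\<close> keeps p nonnegative.\<close>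

lemma drift:
  assumes c: "a n = L" "c n = L" "b n = 0" and K: "K \<ge> 2"
    and eta: "0 < \<eta>" "0 \<le> \<sigma>" and L: "\<eta> * L \<le> 2 / 3"
  shows "E (\<lambda>z. start z r n) \<le> - (\<eta> * \<sigma> / 6) * (1 - (1 - 3 / 2 * (\<eta> * L)) ^ (K * r))"
proof (induction r)
  case 0
  then show ?case by simp
next
  case (Suc r)
  define \<theta> where "\<theta> = \<eta> * L"
  define p where "p = 1 - 3 / 2 * \<theta>"
  define s where "s = \<eta> * \<sigma>"
  define e where "e m k = E (\<lambda>z. iter z m k r n)" for m k
  have L0: "0 < L" using a_pos[OF n_lt] c by simp
  have \<theta>: "0 < \<theta>" "0 \<le> p" "p \<le> 1" "0 \<le> s"
    using L L0 eta by (auto simp: \<theta>_def p_def s_def)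
  have rv: "bounded_rv (\<lambda>z. iter z m k r n)" for m k
    using n_lt by (rule bounded_rv_iter_start)
  have iter: "iter z m (Suc k) r n
      = iter z m k r n - \<theta> * iter z m k r n - \<theta> * max (iter z m k r n) 0 - s * noise (z (m, k, r))"
    for z m k
    using n_lt by (simp add: iter_Suc piece_deriv_def c \<theta>_def s_def algebra_simps)
  have rec: "e m (Suc k) = (1 - \<theta>) * e m k - \<theta> * E (\<lambda>z. max (iter z m k r n) 0)" for m k
    unfolding e_def iter
    by (simp add: bounded_rv_integrable bounded_rv_intros bounded_rv_cmult rv expectation_noise
        algebra_simps)
  have pos: "0 \<le> E (\<lambda>z. max (iter z m k r n) 0)" for m k
    by (intro integral_nonneg_AE) auto
  have pos_Suc: "(e m (Suc k) + s) / 2 \<le> E (\<lambda>z. max (iter z m (Suc k) r n) 0)" for m k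
  proof -
    define u where "u z = iter z m k r n - \<theta> * iter z m k r n - \<theta> * max (iter z m k r n) 0" for z
    have u: "bounded_rv u" unfolding u_def by (intro bounded_rv_intros rv)
    have eq: "iter z m (Suc k) r n = u z - s * noise (z (m, k, r))" for z
      by (simp add: iter u_def)
    have "e m (Suc k) = E u"
      unfolding e_def eq using u
      by (simp add: bounded_rv_integrable bounded_rv_intros bounded_rv_cmult expectation_noise)
    moreover have "(E u + \<bar>s\<bar>) / 2 \<le> E (\<lambda>z. max (u z - s * noise (z (m, k, r))) 0)"
      by (rule expectation_pos_part_noise[OF u]) (simp add: u_def local_iterate_update)
    ultimately show ?thesis using \<theta> by (simp add: eq)
  qed
  have e0: "e m 0 = E (\<lambda>z. start z r n)" for m by (simp add: e_def iter_0)
  have "p ^ (K * r) \<le> 1" using \<theta> by (simp add: power_le_one)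
  then have "0 \<le> s / 6 * (1 - p ^ (K * r))" using \<theta> by (intro mult_nonneg_nonneg) auto
  moreover have e0_le: "e m 0 \<le> - (s / 6) * (1 - p ^ (K * r))" for m
    using Suc by (simp only: e0 s_def p_def \<theta>_def)
  ultimately have e0_neg: "e m 0 \<le> 0" for m by (smt (verit) mult_minus_left)
  have e: "e m (Suc k) \<le> p ^ Suc k * e m 0 - s / 3 * (1 - p ^ k)" for m k
  proof (induction k)
    case 0
    \<comment> \<open>No local noise has entered yet, so the positive part is only known to be
      nonnegative. Since \<open>e m 0 \<le> 0\<close>, the factor \<open>1 - \<theta>\<close> may be
      lowered to p; the drift exponent lags by one.\<close>
    have "e m (Suc 0) \<le> (1 - \<theta>) * e m 0"
      using rec[of m 0] pos[of m 0] \<theta> by simp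
    also have "\<dots> \<le> p * e m 0"
      using \<theta> e0_neg[of m] by (intro mult_right_mono_neg) (auto simp: p_def)
    finally show ?case by simp
  next
    case (Suc k)
    have gen: "p * (P * x - t * (1 - Q)) - t * (1 - p) = p * P * x - t * (1 - p * Q)" for P Q x t
      by (simp add: algebra_simps)
    have "e m (Suc (Suc k)) \<le> (1 - \<theta>) * e m (Suc k) - \<theta> * ((e m (Suc k) + s) / 2)"
      unfolding rec[of m "Suc k"] using pos_Suc[of m k] \<theta> by simp
    also have "\<dots> = p * e m (Suc k) - \<theta> * s / 2" by (simp add: p_def algebra_simps)
    also have "\<dots> \<le> p * (p ^ Suc k * e m 0 - s / 3 * (1 - p ^ k)) - \<theta> * s / 2"
      using Suc \<theta> by (intro diff_right_mono mult_left_mono)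
    also have "\<theta> * s / 2 = s / 3 * (1 - p)" by (simp add: p_def)
    also have "p * (p ^ Suc k * e m 0 - s / 3 * (1 - p ^ k)) - \<dots>
        = p ^ Suc (Suc k) * e m 0 - s / 3 * (1 - p ^ Suc k)"
      using gen[of "p ^ Suc k" "e m 0" "s / 3" "p ^ k"] by (simp only: power_Suc)
    finally show ?case .
  qed
  have eK: "e m K \<le> - (s / 6) * (1 - p ^ (K * Suc r))" for m
  proof -
    have gen: "P * (- t * (1 - X)) - t * (1 - P) = - t * (1 - P * X)" for P X t :: real
      by (simp add: algebra_simps)
    \<comment> \<open>\<open>K \<ge> 2\<close> gives \<open>k \<ge> 1\<close>, so
      \<open>1 - p ^ K = (1 - p ^ k) + p ^ k * (1 - p)\<close> is at most twice
      \<open>1 - p ^ k\<close>. This turns \<open>s / 3\<close> into \<open>s / 6\<close> and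
      restores the exponent K.\<close>
    obtain k where k: "K = Suc k" "1 \<le> k" using K by (cases K) auto
    have "p ^ k \<le> p"
      using power_decreasing[of 1 k p] k \<theta> by simp
    moreover have "p ^ k * (1 - p) \<le> 1 * (1 - p)"
      using \<theta> by (intro mult_right_mono power_le_one) auto
    ultimately have "1 - p ^ K \<le> 2 * (1 - p ^ k)"
      by (simp add: k algebra_simps)
    then have "s / 6 * (1 - p ^ K) \<le> s / 6 * (2 * (1 - p ^ k))"
      using \<theta> by (intro mult_left_mono) auto
    then have "e m K \<le> p ^ K * e m 0 - s / 6 * (1 - p ^ K)"
      using e[of m k] unfolding k by linarith
    also have "\<dots> \<le> p ^ K * (- (s / 6) * (1 - p ^ (K * r))) - s / 6 * (1 - p ^ K)"
      using e0_le \<theta> by (intro diff_right_mono mult_left_mono) auto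
    also have "\<dots> = - (s / 6) * (1 - p ^ (K * Suc r))"
      using gen[of "p ^ K" "s / 6" "p ^ (K * r)"] by (simp only: mult_Suc_right power_add)
    finally show ?thesis .
  qed
  have "E (\<lambda>z. start z (Suc r) n) = (\<Sum>m<M. e m K) / real M"
    by (simp add: start_Suc e_def bounded_rv_integrable rv)
  also have "\<dots> \<le> (\<Sum>m<M. - (s / 6) * (1 - p ^ (K * Suc r))) / real M"
    by (intro divide_right_mono sum_mono eK) auto
  also have "\<dots> = - (s / 6) * (1 - p ^ (K * Suc r))"
    using M_ge by simp
  finally show ?case by (simp only: s_def p_def \<theta>_def)
qed

end

section \<open>Hard instances\<close>

text \<open>Bernoulli's inequality, then squaring. Negative x are included, so negative stepsizes
  fall under this case too.\<close>

lemma half_contraction: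
  fixes x :: real
  assumes "N \<ge> 1" "real N * x \<le> 1 / 2"
  shows "1 / 4 \<le> (1 - x) ^ (2 * N)"
proof -
  have "x \<le> 1"
  proof (cases "0 \<le> x")
    case True
    then have "1 * x \<le> real N * x" using assms by (intro mult_right_mono) auto
    then show ?thesis using assms by simp
  qed simp
  then have "1 - real N * x \<le> (1 - x) ^ N"
    using Bernoulli_inequality[of "- x" N] by simp
  then have "1 / 2 \<le> (1 - x) ^ N" using assms by simp
  then have "(1 / 2)\<^sup>2 \<le> ((1 - x) ^ N)\<^sup>2" by (intro power_mono) auto
  also have "((1 - x) ^ N)\<^sup>2 = (1 - x) ^ (2 * N)" by (simp add: power_mult[symmetric] mult.commute)
  finally show ?thesis by (simp add: power2_eq_square)
qed

lemma even_power_ge_one: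
  fixes x :: real
  assumes "1 \<le> \<bar>x\<bar>"
  shows "1 \<le> x ^ (2 * N)"
  using one_le_power[of "x\<^sup>2" N] one_le_power[of "\<bar>x\<bar>" 2] assms by (simp add: power_mult)

text \<open>A rational substitute for exponential decay: Bernoulli bounds \<open>1 + N * y\<close>
  by \<open>(1 + y) ^ N\<close>, and the product is a power of \<open>1 - y\<^sup>2\<close>.\<close>

lemma power_decay:
  fixes y :: real
  assumes "0 \<le> y" "y \<le> 1"
  shows "(1 - y) ^ N * (1 + real N * y) \<le> 1"
proof -
  have "(1 - y) ^ N * (1 + real N * y) \<le> (1 - y) ^ N * (1 + y) ^ N"
    using assms Bernoulli_inequality[of y N] by (intro mult_left_mono) auto
  also have "\<dots> = (1 - y\<^sup>2) ^ N"
    by (simp add: power_mult_distrib[symmetric] power2_eq_square algebra_simps)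
  also have "\<dots> \<le> 1" using assms by (intro power_le_one) (auto simp: power_le_one)
  finally show ?thesis .
qed

text \<open>One notion serves both classes: \<open>\<beta> = B / 2\<close> yields the radius B, and
  \<open>\<beta> = sqrt (\<Delta> / \<mu>)\<close> yields the initial gap \<open>\<Delta>\<close>.
  The stepsize is quantified last, so one instance defeats all of them.\<close>

definition hard_instance ::
  "nat \<Rightarrow> real \<Rightarrow> real \<Rightarrow> real \<Rightarrow> real \<Rightarrow> nat \<Rightarrow> nat \<Rightarrow> nat \<Rightarrow> real \<Rightarrow> bool" where
  "hard_instance d \<mu> H \<beta> \<sigma> M K R l \<longleftrightarrow>
    (\<exists>F g. strongly_convex_Rn d \<mu> F \<and> smooth_Rn d H F \<and>
      (\<exists>x. is_arg_min F (\<lambda>y. y \<in> Rn d) x \<and> norm_Rn d x \<le> 2 * \<beta>) \<and>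
      F (\<lambda>_. 0) - min_value d F \<le> \<mu> * \<beta>\<^sup>2 \<and>
      stochastic_gradient_oracle d F \<sigma> coin g \<and>
      (\<forall>\<eta>. local_sgd_suboptimality_ge d F coin g \<eta> M K R l))"

lemma (in noisy_objective) hard_instanceI:
  assumes "0 \<le> H" "0 \<le> \<beta>" "M \<ge> 1" "R \<ge> 1"
    and "(\<Sum>i<d. (b i)\<^sup>2) \<le> 4 * \<beta>\<^sup>2" "(\<Sum>i<d. a i * (b i)\<^sup>2) \<le> 2 * \<mu> * \<beta>\<^sup>2"
    and l: "\<And>\<eta>. l \<le> samples.expectation (\<lambda>z. F (round_start noisy_grad \<eta> M K z R))"
  shows "hard_instance d \<mu> H \<beta> \<sigma> M K R l"
  unfolding hard_instance_def
proof (intro exI conjI allI)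
  have "norm_Rn d b \<le> sqrt (4 * \<beta>\<^sup>2)"
    using assms(5) unfolding norm_Rn_sq[symmetric] by (intro real_le_rsqrt)
  then show "norm_Rn d b \<le> 2 * \<beta>" using assms(2) by (simp add: real_sqrt_mult)
  have "F (\<lambda>_. 0) = (\<Sum>i<d. a i * (b i)\<^sup>2) / 2"
    by (simp add: separable_def piece_def sum_divide_distrib)
  then show "F (\<lambda>_. 0) - min_value d F \<le> \<mu> * \<beta>\<^sup>2"
    using assms(6) by (simp add: min_value_F)
  fix \<eta>
  interpret local_sgd_run d a b c \<mu> H n \<sigma> \<eta> M K
    using \<open>M \<ge> 1\<close> by unfold_locales
  show "local_sgd_suboptimality_ge d F coin noisy_grad \<eta> M K R l"
    using \<open>R \<ge> 1\<close> l by (rule suboptimalityI)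
qed (use assms in \<open>auto intro: strongly_convex_F smooth_F is_arg_min_F stochastic_gradient_oracle\<close>)

text \<open>All three curvature scales are needed: coordinate 0 (curvature \<open>\<mu>\<close>) rules out
  stepsizes below \<open>1 / (2 \<mu> K R)\<close>, coordinate 1 (curvature H) those above \<open>2 / H\<close>, and for the
  remaining ones the drift of coordinate 2 is at least a multiple of \<open>\<eta> \<sigma>\<close>.\<close>

lemma drift_instance:
  assumes mu: "0 < \<mu>" "\<mu> \<le> H / 16" and pos: "0 < \<beta>" "0 < \<sigma>"
    and nat: "K \<ge> 2" "M \<ge> 1" "R \<ge> 1" "d \<ge> 3"
  shows "hard_instance d \<mu> H \<beta> \<sigma> M K R
    (1 / 3200 * min (H * \<sigma>\<^sup>2 / (\<mu>\<^sup>2 * (real K)\<^sup>2 * (real R)\<^sup>2)) (\<mu> * \<beta>\<^sup>2))"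
proof -
  \<comment> \<open>Coordinate 2 has curvature \<open>H / 4\<close> on the left and
    \<open>H / 2\<close> on the right, so \<open>\<eta> < 2 / H\<close> keeps
    \<open>\<eta> * L\<close> below 1/2, within the range of \<open>drift\<close>.\<close>
  define a where "a i = (if i = 1 then H else if i = 2 then H / 4 else \<mu>)" for i :: nat
  \<comment> \<open>\<open>b 1\<close> is scaled so that coordinate 1 starts with the same gap
    \<open>\<mu> * \<beta>\<^sup>2 / 2\<close> as coordinate 0.\<close>
  define b where "b i = (if i = 0 then \<beta> else if i = 1 then \<beta> * sqrt (\<mu> / H) else 0)" for i :: nat
  define c where "c i = (if i = 2 then H / 4 else 0)" for i :: nat
  define N where "N = real K * real R"
  have N: "1 \<le> K * R" "real (K * R) = N" "0 < N" using nat by (auto simp: N_def)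
  have H: "0 < H" using mu by linarith
  have b1: "(b 1)\<^sup>2 = \<beta>\<^sup>2 * \<mu> / H" using mu H by (simp add: b_def power_mult_distrib)
  interpret noisy_objective d a b c \<mu> H 2 \<sigma>
    using mu H nat by unfold_locales (auto simp: a_def b_def c_def mem_Rn)
  have sum: "(\<Sum>i<d. f i * (b i)\<^sup>2) = f 0 * \<beta>\<^sup>2 + f 1 * (\<beta>\<^sup>2 * \<mu> / H)" for f
  proof -
    have "(\<Sum>i<d. f i * (b i)\<^sup>2) = (\<Sum>i\<in>{0, 1}. f i * (b i)\<^sup>2)"
      using nat by (intro sum.mono_neutral_right) (auto simp: b_def)
    then show ?thesis using b1 by (simp add: b_def)
  qed
  show ?thesis
  proof (rule hard_instanceI)
    have "\<beta>\<^sup>2 * \<mu> / H \<le> \<beta>\<^sup>2 * 1"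
      unfolding times_divide_eq_right[symmetric] using mu H by (intro mult_left_mono) auto
    then have "1 * \<beta>\<^sup>2 + 1 * (\<beta>\<^sup>2 * \<mu> / H) \<le> 4 * \<beta>\<^sup>2"
      using zero_le_power2[of \<beta>] by linarith
    then show "(\<Sum>i<d. (b i)\<^sup>2) \<le> 4 * \<beta>\<^sup>2"
      using sum[of "\<lambda>_. 1"] by simp
    show "(\<Sum>i<d. a i * (b i)\<^sup>2) \<le> 2 * \<mu> * \<beta>\<^sup>2"
      using H by (simp add: sum a_def)
    fix \<eta>
    interpret local_sgd_run d a b c \<mu> H 2 \<sigma> \<eta> M K
      using nat by unfold_locales
    let ?l = "1 / 3200 * min (H * \<sigma>\<^sup>2 / (\<mu>\<^sup>2 * (real K)\<^sup>2 * (real R)\<^sup>2)) (\<mu> * \<beta>\<^sup>2)"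
    have l2: "?l \<le> 1 / 3200 * (\<mu> * \<beta>\<^sup>2)" by (intro mult_left_mono) auto
    have mb: "0 \<le> \<mu> * \<beta>\<^sup>2" using mu by simp
    consider "N * (\<eta> * \<mu>) \<le> 1 / 2" | "\<eta> \<ge> 2 / H" | "N * (\<eta> * \<mu>) > 1 / 2" "\<eta> < 2 / H" by linarith
    then show "?l \<le> E (\<lambda>z. F (start z R))"
    proof cases
      case 1
      have "\<mu> / 2 * \<beta>\<^sup>2 * (1 / 4) \<le> \<mu> / 2 * \<beta>\<^sup>2 * (1 - \<eta> * \<mu>) ^ (2 * (K * R))"
        using half_contraction[of "K * R" "\<eta> * \<mu>"] 1 N mu by (intro mult_left_mono) auto
      then show ?thesis
        using noiseless_error[of 0 R] nat l2 mb by (simp add: a_def b_def c_def)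
    next
      case 2
      then have "2 \<le> \<eta> * H" using H by (simp add: field_simps)
      then have "H / 2 * (b 1)\<^sup>2 * 1 \<le> H / 2 * (b 1)\<^sup>2 * (1 - \<eta> * H) ^ (2 * (K * R))"
        using even_power_ge_one[of "1 - \<eta> * H" "K * R"] H by (intro mult_left_mono) auto
      moreover have "H / 2 * (b 1)\<^sup>2 = \<mu> * \<beta>\<^sup>2 / 2" unfolding b1 using H by simp
      ultimately show ?thesis
        using noiseless_error[of 1 R] nat l2 mb by (simp add: a_def c_def)
    next
      case 3
      have eta: "0 < \<eta>"
      proof (rule ccontr)
        assume "\<not> 0 < \<eta>"
        then have "N * (\<eta> * \<mu>) \<le> 0"
          using N mu by (intro mult_nonneg_nonpos mult_nonpos_nonneg) auto
        then show False using 3 by simp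
      qed
      define y where "y = 3 / 2 * (\<eta> * (H / 4))"
      define p where "p = 1 - y"
      define e where "e = E (\<lambda>z. start z R 2)"
      have "\<eta> * (H / 4) \<le> 1 / 2" using 3 H by (simp add: field_simps)
      then have th: "\<eta> * (H / 4) \<le> 2 / 3" by linarith
      \<comment> \<open>With \<open>\<mu> \<le> H / 16\<close> this makes \<open>N * y\<close> at
        least 3, so \<open>power_decay\<close> gives \<open>p ^ (K * R) \<le> 1 / 4\<close>, and the
        drift reaches 3/4 of \<open>\<eta> * \<sigma> / 6\<close>.\<close>
      have "1 / 2 < N * (\<eta> * \<mu>)" by (rule 3)
      also have "\<dots> \<le> N * (\<eta> * (H / 16))"
        using N eta mu by (intro mult_left_mono) auto
      finally have Ny: "3 \<le> real (K * R) * y"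
        unfolding N(2) y_def by (simp add: mult_ac)
      have y: "0 \<le> y" "y \<le> 1"
      proof -
        show "0 \<le> y" using eta H by (simp add: y_def)
        show "y \<le> 1" unfolding y_def using th by linarith
      qed
      then have "p ^ (K * R) * 4 \<le> p ^ (K * R) * (1 + real (K * R) * y)"
        using Ny by (intro mult_left_mono) (auto simp: p_def)
      also have "\<dots> \<le> 1" unfolding p_def using y by (rule power_decay)
      finally have "\<eta> * \<sigma> / 6 * (3 / 4) \<le> \<eta> * \<sigma> / 6 * (1 - p ^ (K * R))"
        using eta pos by (intro mult_left_mono) auto
      moreover have "e \<le> - (\<eta> * \<sigma> / 6) * (1 - p ^ (K * R))"
        unfolding p_def y_def e_def by (rule drift[where L = "H / 4"])
          (use nat eta pos th in \<open>simp_all add: a_def b_def c_def\<close>)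
      ultimately have "\<eta> * \<sigma> / 8 \<le> - e" by simp
      then have "(\<eta> * \<sigma> / 8)\<^sup>2 \<le> e\<^sup>2"
        using power_mono[of "\<eta> * \<sigma> / 8" "- e" 2] eta pos by simp
      have x: "bounded_rv (\<lambda>z. start z R 2)" using nat by (intro bounded_rv_iter_start) simp
      \<comment> \<open>A variance is nonnegative, so a displaced mean forces a large second
        moment.\<close>
      have "e\<^sup>2 \<le> E (\<lambda>z. (start z R 2)\<^sup>2)"
        using samples.variance_positive[of "\<lambda>z. start z R 2"]
        by (simp add: samples.variance_eq bounded_rv_integrable bounded_rv_power2 x e_def)
      then have "H / 8 * (\<eta> * \<sigma> / 8)\<^sup>2 \<le> H / 8 * E (\<lambda>z. (start z R 2)\<^sup>2)"
        using \<open>(\<eta> * \<sigma> / 8)\<^sup>2 \<le> e\<^sup>2\<close> H by (intro mult_left_mono) auto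
      also have "\<dots> = E (\<lambda>z. H / 8 * (start z R 2)\<^sup>2)" by simp
      also have "\<dots> \<le> E (\<lambda>z. piece (a 2) (b 2) (c 2) (start z R 2))"
        unfolding piece_def using H
        by (intro integral_mono bounded_rv_integrable bounded_rv_intros bounded_rv_cmult x)
          (auto simp: a_def b_def c_def)
      also have "\<dots> \<le> E (\<lambda>z. F (start z R))" using nat by (intro expectation_piece_le) simp
      finally have *: "H / 8 * (\<eta> * \<sigma> / 8)\<^sup>2 \<le> E (\<lambda>z. F (start z R))" .
      \<comment> \<open>Inserting this lower bound on the stepsize into
        \<open>H * \<sigma>\<^sup>2 * \<eta>\<^sup>2 / 512\<close> gives the factor 1/2048, which
        exceeds 1/3200.\<close>
      have "1 / (2 * N * \<mu>) \<le> \<eta>" using 3 N mu by (simp add: field_simps)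
      then have "(1 / (2 * N * \<mu>))\<^sup>2 \<le> \<eta>\<^sup>2" using N mu by (intro power_mono) auto
      then have "H * \<sigma>\<^sup>2 / 512 * (1 / (2 * N * \<mu>))\<^sup>2 \<le> H * \<sigma>\<^sup>2 / 512 * \<eta>\<^sup>2"
        using H by (intro mult_left_mono) auto
      then have "1 / 2048 * (H * \<sigma>\<^sup>2 / (\<mu>\<^sup>2 * (real K)\<^sup>2 * (real R)\<^sup>2)) \<le> E (\<lambda>z. F (start z R))"
        using * by (simp add: power_mult_distrib power_divide N_def mult_ac)
      moreover have "0 \<le> H * \<sigma>\<^sup>2 / (\<mu>\<^sup>2 * (real K)\<^sup>2 * (real R)\<^sup>2)" using H by simp
      ultimately show ?thesis by linarith
    qed
  qed (use H pos nat in auto)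
qed

text \<open>Initial error and noise share coordinate 0: stepsizes that are too small or too large
  preserve the initial error, and the others leave a noise floor.\<close>

lemma variance_instance:
  assumes mu: "0 < \<mu>" "\<mu> \<le> H" and pos: "0 < \<beta>"
    and nat: "K \<ge> 1" "M \<ge> 1" "R \<ge> 1" "d \<ge> 1"
  shows "hard_instance d \<mu> H \<beta> \<sigma> M K R
    (1 / 8 * min (\<sigma>\<^sup>2 / (\<mu> * real M * real K * real R)) (\<mu> * \<beta>\<^sup>2))"
proof -
  define b where "b i = (if i = 0 then \<beta> else 0)" for i :: nat
  define N where "N = real K * real R"
  have N: "1 \<le> K * R" "real (K * R) = N" "0 < N" using nat by (auto simp: N_def)
  interpret noisy_objective d "\<lambda>_. \<mu>" b "\<lambda>_. 0" \<mu> H 0 \<sigma>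
    using mu nat by unfold_locales (auto simp: b_def mem_Rn)
  have sum: "(\<Sum>i<d. (b i)\<^sup>2) = \<beta>\<^sup>2"
  proof -
    have "(\<Sum>i<d. (b i)\<^sup>2) = (\<Sum>i\<in>{0}. (b i)\<^sup>2)"
      using nat by (intro sum.mono_neutral_right) (auto simp: b_def)
    then show ?thesis by (simp add: b_def)
  qed
  show ?thesis
  proof (rule hard_instanceI)
    show "(\<Sum>i<d. (b i)\<^sup>2) \<le> 4 * \<beta>\<^sup>2" by (simp add: sum)
    show "(\<Sum>i<d. \<mu> * (b i)\<^sup>2) \<le> 2 * \<mu> * \<beta>\<^sup>2"
      using mu by (simp add: sum sum_distrib_left[symmetric])
    fix \<eta>
    interpret local_sgd_run d "\<lambda>_. \<mu>" b "\<lambda>_. 0" \<mu> H 0 \<sigma> \<eta> M K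
      using nat by unfold_locales
    let ?l = "1 / 8 * min (\<sigma>\<^sup>2 / (\<mu> * real M * real K * real R)) (\<mu> * \<beta>\<^sup>2)"
    define q where "q = 1 - \<eta> * \<mu>"
    define V where "V = E (\<lambda>z. (start z R 0 - b 0)\<^sup>2)"
    have V: "\<mu> / 2 * V \<le> E (\<lambda>z. F (start z R))"
      using expectation_piece_le[of 0 R] nat by (simp add: piece_def V_def)
    have initial: "q ^ (2 * (K * R)) * \<beta>\<^sup>2 \<le> V"
      unfolding V_def q_def
      by (rule second_moment_recursion[where W = "\<lambda>t. (1 - \<eta> * \<mu>) ^ (2 * t) * \<beta>\<^sup>2"])
        (auto simp: b_def power2_eq_square[of "1 - \<eta> * \<mu>"] mult_ac)
    have l2: "?l \<le> 1 / 8 * (\<mu> * \<beta>\<^sup>2)" by (intro mult_left_mono) auto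
    have *: "?l \<le> E (\<lambda>z. F (start z R))" if "1 / 4 \<le> q ^ (2 * (K * R))"
    proof -
      have "1 / 4 * \<beta>\<^sup>2 \<le> V" using initial mult_right_mono[OF that, of "\<beta>\<^sup>2"] by simp
      then have "\<mu> / 2 * (1 / 4 * \<beta>\<^sup>2) \<le> \<mu> / 2 * V" using mu by (intro mult_left_mono) auto
      then show ?thesis using V l2 by simp
    qed
    consider "N * (\<eta> * \<mu>) \<le> 1 / 2" | "\<eta> * \<mu> \<ge> 2" | "N * (\<eta> * \<mu>) > 1 / 2" "\<eta> * \<mu> < 2" by linarith
    then show "?l \<le> E (\<lambda>z. F (start z R))"
    proof cases
      case 1
      then show ?thesis
        using half_contraction[of "K * R" "\<eta> * \<mu>"] N by (intro *) (auto simp: q_def)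
    next
      case 2
      then show ?thesis
        using even_power_ge_one[of q "K * R"] by (intro *) (auto simp: q_def)
    next
      case 3
      have eta: "0 < \<eta>"
      proof (rule ccontr)
        assume "\<not> 0 < \<eta>"
        then have "N * (\<eta> * \<mu>) \<le> 0"
          using N mu by (intro mult_nonneg_nonpos mult_nonpos_nonneg) auto
        then show False using 3 by simp
      qed
      \<comment> \<open>A constant subsolution:
        \<open>1 - q\<^sup>2 \<le> 2 * \<eta> * \<mu>\<close>, so the contraction loses at most the
        injected \<open>\<eta>\<^sup>2 * \<sigma>\<^sup>2 / M\<close>; the cap
        \<open>\<beta>\<^sup>2\<close> keeps it below the initial error.\<close>
      define w where "w = min (\<beta>\<^sup>2) (\<eta> * \<sigma>\<^sup>2 / (2 * \<mu> * real M))"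
      have w0: "0 \<le> w" using eta mu by (simp add: w_def)
      have "(1 - q\<^sup>2) * w \<le> (2 * (\<eta> * \<mu>)) * w"
        using w0 eta mu by (intro mult_right_mono) (auto simp: q_def power2_eq_square algebra_simps)
      also have "\<dots> \<le> (2 * (\<eta> * \<mu>)) * (\<eta> * \<sigma>\<^sup>2 / (2 * \<mu> * real M))"
        using eta mu by (intro mult_left_mono) (auto simp: w_def)
      also have "\<dots> = \<eta>\<^sup>2 * \<sigma>\<^sup>2 / real M" using mu by (simp add: power2_eq_square)
      finally have "w \<le> q\<^sup>2 * w + \<eta>\<^sup>2 * \<sigma>\<^sup>2 / real M" by (simp add: algebra_simps)
      then have "w \<le> V"
        unfolding V_def q_def
        by (intro second_moment_recursion[where W = "\<lambda>_. w"]) (auto simp: b_def w_def)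
      then have "\<mu> / 2 * w \<le> \<mu> / 2 * V" using mu by (intro mult_left_mono) auto
      moreover have "?l \<le> \<mu> / 2 * w"
      proof -
        have "1 / (2 * N * \<mu>) \<le> \<eta>" using 3 N mu by (simp add: field_simps)
        then have "1 / (2 * N * \<mu>) * (\<sigma>\<^sup>2 / (4 * real M)) \<le> \<eta> * (\<sigma>\<^sup>2 / (4 * real M))"
          by (intro mult_right_mono) auto
        then have "1 / 8 * (\<sigma>\<^sup>2 / (\<mu> * real M * real K * real R)) \<le> \<mu> / 2 * (\<eta> * \<sigma>\<^sup>2 / (2 * \<mu> * real M))"
          using mu by (simp add: N_def mult_ac)
        moreover have "?l \<le> 1 / 8 * (\<sigma>\<^sup>2 / (\<mu> * real M * real K * real R))"
          by (intro mult_left_mono) auto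
        moreover have "?l \<le> \<mu> / 2 * \<beta>\<^sup>2"
          by (rule order_trans[OF l2]) (use mu in simp)
        ultimately show ?thesis
          by (cases "\<beta>\<^sup>2 \<le> \<eta> * \<sigma>\<^sup>2 / (2 * \<mu> * real M)") (simp_all only: w_def min_def if_True if_False)
      qed
      ultimately show ?thesis using V by linarith
    qed
  qed (use mu pos nat in auto)
qed

section \<open>Transfer to the two function classes and choice of the curvature\<close>

lemma hard_instance_convex_class:
  assumes "hard_instance d \<mu> H (B / 2) \<sigma> M K R l" "0 \<le> \<mu>" "l' \<le> l"
  shows "\<exists>F \<in> convex_class d H B. \<exists>(D::real measure) g. stochastic_gradient_oracle d F \<sigma> D g \<and>
    (\<forall>\<eta>. local_sgd_suboptimality_ge d F D g \<eta> M K R l')"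
proof -
  obtain F g where F: "strongly_convex_Rn d \<mu> F" "smooth_Rn d H F"
      "\<exists>x. is_arg_min F (\<lambda>y. y \<in> Rn d) x \<and> norm_Rn d x \<le> B"
      "stochastic_gradient_oracle d F \<sigma> coin g"
      "\<And>\<eta>. local_sgd_suboptimality_ge d F coin g \<eta> M K R l"
    using assms(1) unfolding hard_instance_def by auto
  have "convex_Rn d F"
    unfolding convex_Rn_def
  proof (intro ballI)
    fix x y and t :: real assume *: "x \<in> Rn d" "y \<in> Rn d" "t \<in> {0..1}"
    have "0 \<le> \<mu> / 2 * t * (1 - t) * (norm_Rn d (\<lambda>i. x i - y i))\<^sup>2"
      using * assms(2) by (intro mult_nonneg_nonneg) auto
    then show "F (\<lambda>i. (1 - t) * x i + t * y i) \<le> (1 - t) * F x + t * F y"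
      using F(1) * unfolding strongly_convex_Rn_def by fastforce
  qed
  then have "F \<in> convex_class d H B" using F by (simp add: convex_class_def)
  moreover have "local_sgd_suboptimality_ge d F coin g \<eta> M K R l'" for \<eta>
    using F(5)[of \<eta>] assms(3) by (auto simp: local_sgd_suboptimality_ge_def)
  ultimately show ?thesis using F(4) by blast
qed

lemma hard_instance_strongly_convex_class:
  assumes "hard_instance d \<mu> H (sqrt (\<Delta> / \<mu>)) \<sigma> M K R l" "0 < \<mu>" "0 \<le> \<Delta>" "l' \<le> l"
  shows "\<exists>F \<in> strongly_convex_class d \<mu> H \<Delta>.
    \<exists>(D::real measure) g. stochastic_gradient_oracle d F \<sigma> D g \<and>
    (\<forall>\<eta>. local_sgd_suboptimality_ge d F D g \<eta> M K R l')"
proof -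
  obtain F g where F: "F \<in> strongly_convex_class d \<mu> H \<Delta>"
      "stochastic_gradient_oracle d F \<sigma> coin g"
      "\<And>\<eta>. local_sgd_suboptimality_ge d F coin g \<eta> M K R l"
    using assms unfolding hard_instance_def strongly_convex_class_def by auto
  have "local_sgd_suboptimality_ge d F coin g \<eta> M K R l'" for \<eta>
    using F(3)[of \<eta>] assms(4) by (auto simp: local_sgd_suboptimality_ge_def)
  then show ?thesis using F by blast
qed

text \<open>In the convex case the curvature is chosen so that both arguments of the minimum in
  \<open>drift_instance\<close> (or \<open>variance_instance\<close>) are of the order of the claimed rate T, capped by H.\<close>

lemma convex_drift:
  assumes pos: "0 < H" "0 < B" "0 < \<sigma>" and nat: "K \<ge> 2" "M \<ge> 1" "R \<ge> 1" "d \<ge> 3"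
  defines "T \<equiv> (H * \<sigma>\<^sup>2 * B ^ 4) powr (1 / 3) / (real K powr (2 / 3) * real R powr (2 / 3))"
  shows "\<exists>\<mu>>0. \<exists>l. hard_instance d \<mu> H (B / 2) \<sigma> M K R l \<and> min T (H * B\<^sup>2) \<le> 204800 * l"
proof -
  have KR: "0 < real K" "0 < real R" using nat by auto
  have T0: "0 < T" using pos KR by (simp add: T_def)
  have cube: "(x powr (e / 3)) ^ 3 = x powr e" if "0 < x" for x e :: real
    using powr_realpow[of "x powr (e / 3)" 3] that by (simp add: powr_powr)
  have T3: "T ^ 3 = H * \<sigma>\<^sup>2 * B ^ 4 / ((real K)\<^sup>2 * (real R)\<^sup>2)"
    using cube[of "H * \<sigma>\<^sup>2 * B ^ 4" 1] cube[of "real K" 2] cube[of "real R" 2] pos KR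
    by (simp add: T_def power_divide power_mult_distrib powr_numeral)
  \<comment> \<open>By \<open>T3\<close>, at \<open>\<mu> = T / B\<^sup>2\<close> both
    \<open>?S\<close> and \<open>\<mu> * B\<^sup>2\<close> equal T. The cap is the condition of
    \<open>drift_instance\<close>.\<close>
  define \<mu> where "\<mu> = min (T / B\<^sup>2) (H / 16)"
  have mu: "0 < \<mu>" using pos T0 by (simp add: \<mu>_def)
  have mu_le: "\<mu> \<le> T / B\<^sup>2" "\<mu> \<le> H / 16"
    unfolding \<mu>_def by (rule min.cobounded1 min.cobounded2)+
  let ?S = "H * \<sigma>\<^sup>2 / (\<mu>\<^sup>2 * (real K)\<^sup>2 * (real R)\<^sup>2)"
  define l where "l = 1 / 3200 * min ?S (\<mu> * (B / 2)\<^sup>2)"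
  have "\<mu> * B\<^sup>2 \<le> T" using mu_le(1) pos by (simp add: field_simps)
  then have "(\<mu> * B\<^sup>2) ^ 3 \<le> T ^ 3" using mu by (intro power_mono) auto
  then have le: "(\<mu> * B\<^sup>2) ^ 3 * ((real K)\<^sup>2 * (real R)\<^sup>2) \<le> H * \<sigma>\<^sup>2 * B ^ 4"
    using KR by (simp add: T3 pos_le_divide_eq)
  have eq: "(\<mu> * B\<^sup>2) ^ 3 * ((real K)\<^sup>2 * (real R)\<^sup>2)
      = (\<mu> * B\<^sup>2) * (\<mu>\<^sup>2 * (real K)\<^sup>2 * (real R)\<^sup>2) * B ^ 4"
    by (simp only: power2_eq_square power3_eq_cube power4_eq_xxxx mult_ac)
  have "(\<mu> * B\<^sup>2) * (\<mu>\<^sup>2 * (real K)\<^sup>2 * (real R)\<^sup>2) \<le> H * \<sigma>\<^sup>2"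
    by (rule mult_right_le_imp_le[OF le[unfolded eq]]) (use pos in simp)
  then have "\<mu> * B\<^sup>2 \<le> ?S"
    using KR mu by (subst pos_le_divide_eq) auto
  moreover have "0 < \<mu> * B\<^sup>2" using mu pos by simp
  moreover have quarter: "\<mu> * (B / 2)\<^sup>2 = \<mu> * B\<^sup>2 / 4" by (simp add: power_divide)
  ultimately have "\<mu> * (B / 2)\<^sup>2 \<le> ?S" by linarith
  then have "\<mu> * B\<^sup>2 / 12800 \<le> l" by (simp add: l_def min_absorb2 quarter)
  \<comment> \<open>The factor 16 is the price of the cap \<open>H / 16\<close>. With 4 from
    \<open>(B / 2)\<^sup>2\<close> and 3200 from \<open>drift_instance\<close> it makes up
    204800.\<close>
  moreover have "min T (H * B\<^sup>2) \<le> 16 * (\<mu> * B\<^sup>2)"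
  proof (cases "T / B\<^sup>2 \<le> H / 16")
    case True
    then have "\<mu> * B\<^sup>2 = T" using pos by (simp add: \<mu>_def)
    then show ?thesis using T0 by simp
  next
    case False
    then show ?thesis by (simp add: \<mu>_def)
  qed
  ultimately have "min T (H * B\<^sup>2) \<le> 204800 * l" by linarith
  moreover have "hard_instance d \<mu> H (B / 2) \<sigma> M K R l"
    unfolding l_def using mu mu_le(2) pos nat by (intro drift_instance) auto
  ultimately show ?thesis using mu by blast
qed

lemma convex_variance:
  assumes pos: "0 < H" "0 < B" "0 < \<sigma>" and nat: "K \<ge> 1" "M \<ge> 1" "R \<ge> 1" "d \<ge> 1"
  defines "T \<equiv> \<sigma> * B / sqrt (real M * real K * real R)"
  shows "\<exists>\<mu>>0. \<exists>l. hard_instance d \<mu> H (B / 2) \<sigma> M K R l \<and> min T (H * B\<^sup>2) \<le> 204800 * l"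
proof -
  have MKR: "0 < real M" "0 < real K" "0 < real R" using nat by auto
  have T0: "0 < T" using pos MKR by (simp add: T_def)
  have T2: "T\<^sup>2 = \<sigma>\<^sup>2 * B\<^sup>2 / (real M * real K * real R)"
    by (simp add: T_def power_divide power_mult_distrib)
  \<comment> \<open>By \<open>T2\<close>, \<open>\<mu> = T / B\<^sup>2\<close> balances
    \<open>?S\<close> with \<open>\<mu> * B\<^sup>2\<close>. Here the cap is H, as
    \<open>variance_instance\<close> allows.\<close>
  define \<mu> where "\<mu> = min (T / B\<^sup>2) H"
  have mu: "0 < \<mu>" "\<mu> \<le> H" using pos T0 by (auto simp: \<mu>_def)
  let ?S = "\<sigma>\<^sup>2 / (\<mu> * real M * real K * real R)"
  define l where "l = 1 / 8 * min ?S (\<mu> * (B / 2)\<^sup>2)"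
  have "\<mu> \<le> T / B\<^sup>2" by (simp add: \<mu>_def)
  then have "\<mu> * B\<^sup>2 \<le> T" using pos by (simp add: field_simps)
  then have "(\<mu> * B\<^sup>2)\<^sup>2 \<le> T\<^sup>2" using mu by (intro power_mono) auto
  then have le: "(\<mu> * B\<^sup>2)\<^sup>2 * (real M * real K * real R) \<le> \<sigma>\<^sup>2 * B\<^sup>2"
    using MKR by (simp add: T2 pos_le_divide_eq)
  have eq: "(\<mu> * B\<^sup>2)\<^sup>2 * (real M * real K * real R)
      = (\<mu> * B\<^sup>2) * (\<mu> * real M * real K * real R) * B\<^sup>2"
    by (simp only: power2_eq_square power3_eq_cube power4_eq_xxxx mult_ac)
  have "(\<mu> * B\<^sup>2) * (\<mu> * real M * real K * real R) \<le> \<sigma>\<^sup>2"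
    by (rule mult_right_le_imp_le[OF le[unfolded eq]]) (use pos in simp)
  then have "\<mu> * B\<^sup>2 \<le> ?S"
    using MKR mu by (subst pos_le_divide_eq) auto
  moreover have "0 < \<mu> * B\<^sup>2" using mu pos by simp
  moreover have quarter: "\<mu> * (B / 2)\<^sup>2 = \<mu> * B\<^sup>2 / 4" by (simp add: power_divide)
  ultimately have "\<mu> * (B / 2)\<^sup>2 \<le> ?S" by linarith
  then have "\<mu> * B\<^sup>2 / 32 \<le> l" by (simp add: l_def min_absorb2 quarter)
  moreover have "min T (H * B\<^sup>2) \<le> \<mu> * B\<^sup>2"
  proof (cases "T / B\<^sup>2 \<le> H")
    case True
    then have "\<mu> * B\<^sup>2 = T" using pos by (simp add: \<mu>_def)
    then show ?thesis by simp
  next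
    case False
    then show ?thesis by (simp add: \<mu>_def)
  qed
  moreover have "0 < \<mu> * B\<^sup>2" using mu pos by simp
  ultimately have "min T (H * B\<^sup>2) \<le> 204800 * l" by linarith
  moreover have "hard_instance d \<mu> H (B / 2) \<sigma> M K R l"
    unfolding l_def using mu pos nat by (intro variance_instance) auto
  ultimately show ?thesis using mu by blast
qed

theorem theorem7:
  shows "\<exists>c::real. c > 0 \<and>
    (\<forall>(H::real) (B::real) (\<Delta>::real) (\<sigma>::real) (K::nat) (M::nat) (R::nat) (d::nat).
      H > 0 \<longrightarrow> B > 0 \<longrightarrow> \<Delta> > 0 \<longrightarrow> \<sigma> > 0 \<longrightarrow>
      K \<ge> 2 \<longrightarrow> M \<ge> 1 \<longrightarrow> R \<ge> 1 \<longrightarrow> d \<ge> 3 \<longrightarrow>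
      (\<exists>F \<in> convex_class d H B.
        \<exists>(D::real measure) g. stochastic_gradient_oracle d F \<sigma> D g \<and>
          (\<forall>\<eta>::real. local_sgd_suboptimality_ge d F D g \<eta> M K R
            (c * (min ((H * \<sigma>\<^sup>2 * B ^ 4) powr (1 / 3) /
                        (real K powr (2 / 3) * real R powr (2 / 3))) (H * B\<^sup>2)
                + min (\<sigma> * B / sqrt (real M * real K * real R)) (H * B\<^sup>2))))) \<and>
      (\<forall>\<mu>::real. 0 < \<mu> \<longrightarrow> \<mu> \<le> H / 16 \<longrightarrow>
        (\<exists>F \<in> strongly_convex_class d \<mu> H \<Delta>.
          \<exists>(D::real measure) g. stochastic_gradient_oracle d F \<sigma> D g \<and>
            (\<forall>\<eta>::real. local_sgd_suboptimality_ge d F D g \<eta> M K R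
              (c * (min (H * \<sigma>\<^sup>2 / (\<mu>\<^sup>2 * (real K)\<^sup>2 * (real R)\<^sup>2)) \<Delta>
                  + min (\<sigma>\<^sup>2 / (\<mu> * real M * real K * real R)) \<Delta>))))))"
proof (intro exI[of _ "1 / 409600 :: real"] conjI allI impI)
  fix H B \<Delta> \<sigma> :: real and K M R d :: nat
  assume pos: "H > 0" "B > 0" "\<Delta> > 0" "\<sigma> > 0"
    and nat: "K \<ge> 2" "M \<ge> 1" "R \<ge> 1" "d \<ge> 3"
  \<comment> \<open>A sum of two terms is at most twice the larger, so the instance is chosen for
    the larger term, and 409600 is twice 204800.\<close>
  have half: "1 / 409600 * (x + y) \<le> l" "1 / 409600 * (y + x) \<le> l"
    if "y \<le> x" "x \<le> 204800 * l" for x y l :: real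
    using that by auto
  have scale: "x \<le> 204800 * (C * x)" if "0 \<le> x" "1 / 3200 \<le> C" for x C :: real
    using mult_right_mono[OF that(2,1)] that by linarith
  let ?A = "min ((H * \<sigma>\<^sup>2 * B ^ 4) powr (1 / 3) / (real K powr (2 / 3) * real R powr (2 / 3))) (H * B\<^sup>2)"
  let ?V = "min (\<sigma> * B / sqrt (real M * real K * real R)) (H * B\<^sup>2)"
  have "\<exists>\<mu>>0. \<exists>l. hard_instance d \<mu> H (B / 2) \<sigma> M K R l \<and> 1 / 409600 * (?A + ?V) \<le> l"
  proof (cases "?V \<le> ?A")
    case True
    have "\<exists>\<mu>>0. \<exists>l. hard_instance d \<mu> H (B / 2) \<sigma> M K R l \<and> ?A \<le> 204800 * l"
      using pos nat by (intro convex_drift) auto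
    then obtain \<mu> l where "\<mu> > 0" "hard_instance d \<mu> H (B / 2) \<sigma> M K R l" "?A \<le> 204800 * l"
      by blast
    moreover from this have "1 / 409600 * (?A + ?V) \<le> l" using True by (intro half)
    ultimately show ?thesis by blast
  next
    case False
    have "\<exists>\<mu>>0. \<exists>l. hard_instance d \<mu> H (B / 2) \<sigma> M K R l \<and> ?V \<le> 204800 * l"
      using pos nat by (intro convex_variance) auto
    then obtain \<mu> l where "\<mu> > 0" "hard_instance d \<mu> H (B / 2) \<sigma> M K R l" "?V \<le> 204800 * l"
      by blast
    moreover from this have "1 / 409600 * (?A + ?V) \<le> l" using False by (intro half) auto
    ultimately show ?thesis by blast
  qed
  then show "\<exists>F \<in> convex_class d H B.
        \<exists>(D::real measure) g. stochastic_gradient_oracle d F \<sigma> D g \<and>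
          (\<forall>\<eta>::real. local_sgd_suboptimality_ge d F D g \<eta> M K R (1 / 409600 * (?A + ?V)))"
    using hard_instance_convex_class by (meson less_imp_le)

  fix \<mu> :: real assume mu: "0 < \<mu>" "\<mu> \<le> H / 16"
  let ?A' = "min (H * \<sigma>\<^sup>2 / (\<mu>\<^sup>2 * (real K)\<^sup>2 * (real R)\<^sup>2)) \<Delta>"
  let ?V' = "min (\<sigma>\<^sup>2 / (\<mu> * real M * real K * real R)) \<Delta>"
  define \<beta> where "\<beta> = sqrt (\<Delta> / \<mu>)"
  have beta: "0 < \<beta>" "\<mu> * \<beta>\<^sup>2 = \<Delta>" using pos mu by (auto simp: \<beta>_def)
  have AV': "0 \<le> ?A'" "0 \<le> ?V'" using pos mu by auto
  have "\<exists>l. hard_instance d \<mu> H \<beta> \<sigma> M K R l \<and> 1 / 409600 * (?A' + ?V') \<le> l"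
  proof (cases "?V' \<le> ?A'")
    case True
    have "hard_instance d \<mu> H \<beta> \<sigma> M K R (1 / 3200 * ?A')"
      unfolding beta(2)[symmetric] using mu pos nat beta by (intro drift_instance) auto
    moreover have "1 / 409600 * (?A' + ?V') \<le> 1 / 3200 * ?A'"
      using True AV' by (intro half scale) auto
    ultimately show ?thesis by blast
  next
    case False
    have "hard_instance d \<mu> H \<beta> \<sigma> M K R (1 / 8 * ?V')"
      unfolding beta(2)[symmetric] using mu pos nat beta by (intro variance_instance) auto
    moreover have "1 / 409600 * (?A' + ?V') \<le> 1 / 8 * ?V'"
      using False AV' by (intro half scale) auto
    ultimately show ?thesis by blast
  qed
  then show "\<exists>F \<in> strongly_convex_class d \<mu> H \<Delta>.
          \<exists>(D::real measure) g. stochastic_gradient_oracle d F \<sigma> D g \<and>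
            (\<forall>\<eta>::real. local_sgd_suboptimality_ge d F D g \<eta> M K R (1 / 409600 * (?A' + ?V')))"
    using hard_instance_strongly_convex_class mu pos unfolding \<beta>_def by (meson less_imp_le)
qed simp

end
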